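(* Let $n\ge1$ and let $\mathbb{F}$ be a field in which $n!$ is invertible. Then the quasisymmetric functions $\{F(M_\sigma,\mathbf{x}):\sigma\in0\{0,1\}^{n-1}\}$ span $\mathcal{QS}ym_n\otimes\mathbb{F}$.
   Context: For a matroid $M$ on finite ground set $E$ with bases $\mathcal{B}(M)$ and $f:E\to\mathbb{P}=\{1,2,\ldots\}$, $f$ is $M$-generic if the minimum of $f(B)=\sum_{e\in B}f(e)$ over bases is attained by a unique base; $F(M,\mathbf{x})=\sum_{f\ M\text{-generic}}\prod_{e\in E}x_{f(e)}$. $\mathcal{QS}ym_n$ is the $\mathbb{Z}$-module of homogeneous quasisymmetric functions of degree $n$ with integer coefficients. For a matroid $M$ of rank $r$ on $E$, let $I(M)=M\oplus(\text{isthmus})$ be the extension by a new element that is an isthmus, and let $P(M)$ be the principal extension of $M$ along the improper flat: the extension by a new element $e$ placed generically without increasing the rank, i.e. the bases of $P(M)$ are the bases of $M$ together with the sets $J\cup\{e\}$ with $J$ an independent set of $M$ of size $r-1$. Let $0\{0,1\}^{n-1}$ be the set of binary strings of length $n$ beginning with $0$. For $\sigma=\sigma_1\cdots\sigma_n$ in this set, $M_\sigma$ is the matroid obtained from the empty matroid (ground set $\emptyset$) by applying, for $i=1,\ldots,n$ in order, the operation $I$ if $\sigma_i=0$ and the operation $P$ if $\sigma_i=1$. *)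

theory Defs
  imports Complex_Main "HOL-Library.FuncSet" "HOL-Library.Poly_Mapping" "HOL-Library.Function_Algebras"
begin

section \<open>Matroids given by their bases\<close>

record 'a base_system =
  ground :: "'a set"
  bases :: "'a set set"

definition matroid :: "'a base_system \<Rightarrow> bool" where
  "matroid M \<longleftrightarrow> finite (ground M) \<and> bases M \<noteq> {} \<and> bases M \<subseteq> Pow (ground M) \<and>
     (\<forall>A\<in>bases M. \<forall>B\<in>bases M. \<forall>x\<in>A - B. \<exists>y\<in>B - A. insert y (A - {x}) \<in> bases M)"

definition indep :: "'a base_system \<Rightarrow> 'a set \<Rightarrow> bool" where
  "indep M J \<longleftrightarrow> (\<exists>B\<in>bases M. J \<subseteq> B)"

definition rank :: "'a base_system \<Rightarrow> nat" where
  "rank M = Max (card ` Collect (indep M))"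

definition empty_matroid :: "'a base_system" where
  "empty_matroid = \<lparr>ground = {}, bases = {{}}\<rparr>"

definition isthmus :: "'a \<Rightarrow> 'a base_system" where
  "isthmus e = \<lparr>ground = {e}, bases = {{e}}\<rparr>"

definition direct_sum :: "'a base_system \<Rightarrow> 'a base_system \<Rightarrow> 'a base_system" where
  "direct_sum M N = \<lparr>ground = ground M \<union> ground N,
     bases = {A \<union> B | A B. A \<in> bases M \<and> B \<in> bases N}\<rparr>"

text \<open>In both extensions the new element \<open>e\<close> is an argument, meant to lie outside the ground set.\<close>

definition isthmus_ext :: "'a \<Rightarrow> 'a base_system \<Rightarrow> 'a base_system" where
  "isthmus_ext e M = direct_sum M (isthmus e)"

definition principal_ext :: "'a \<Rightarrow> 'a base_system \<Rightarrow> 'a base_system" where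
  "principal_ext e M = \<lparr>ground = insert e (ground M),
     bases = bases M \<union> {insert e J | J. indep M J \<and> card J + 1 = rank M}\<rparr>"

definition binary_strings0 :: "nat \<Rightarrow> nat list set" where
  "binary_strings0 n = {\<sigma>. length \<sigma> = n \<and> set \<sigma> \<subseteq> {0, 1} \<and> hd \<sigma> = 0}"

text \<open>The element added at the \<open>i\<close>-th step, counting from 0, is the number \<open>i\<close> itself.\<close>

definition string_matroid :: "nat list \<Rightarrow> nat base_system" where
  "string_matroid \<sigma> =
     fold (\<lambda>(i, s). if s = 0 then isthmus_ext i else principal_ext i) (enumerate 0 \<sigma>) empty_matroid"

lemma matroid_base_finite:
  assumes "matroid M" "B \<in> bases M"
  shows "finite B"
proof -
  have "B \<subseteq> ground M" "finite (ground M)" using assms unfolding matroid_def by blast+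
  then show ?thesis by (rule finite_subset)
qed

lemma matroid_base_card_le:
  assumes "matroid M" "A \<in> bases M" "B \<in> bases M"
  shows "card A \<le> card B"
  using assms(2)
proof (induction "card (A - B)" arbitrary: A)
  case 0
  have fin: "finite A" "finite B"
    using matroid_base_finite[OF assms(1)] assms(3) 0(2) by auto
  with 0(1) have "A \<subseteq> B" by auto
  then show ?case using fin by (simp add: card_mono)
next
  case (Suc k)
  have fin: "finite A" "finite B"
    using matroid_base_finite[OF assms(1)] assms(3) Suc(3) by auto
  from Suc(2) have "A - B \<noteq> {}" by (metis card.empty nat.simps(3))
  then obtain x where x: "x \<in> A - B" by auto
  with assms(1,3) Suc(3) obtain y where y: "y \<in> B - A" "insert y (A - {x}) \<in> bases M"
    unfolding matroid_def by meson
  have "insert y (A - {x}) - B = (A - B) - {x}" using y by auto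
  then have "k = card (insert y (A - {x}) - B)" using x fin Suc(2) by simp
  from Suc(1)[OF this y(2)] have "card (insert y (A - {x})) \<le> card B" .
  moreover have "card (insert y (A - {x})) = card A"
    using x y fin by (metis DiffD1 DiffD2 card.remove card_insert_disjoint finite_Diff)
  ultimately show ?case by simp
qed

lemma matroid_base_card:
  assumes "matroid M" "B \<in> bases M"
  shows "card B = rank M"
proof -
  have "finite (Pow (ground M))" "Collect (indep M) \<subseteq> Pow (ground M)"
    using assms(1) unfolding matroid_def indep_def by (simp, blast)
  then have fin: "finite (card ` Collect (indep M))"
    by (meson finite_imageI finite_subset)
  have "Max (card ` Collect (indep M)) = card B"
  proof (rule Max_eqI[OF fin])
    show "card B \<in> card ` Collect (indep M)" using assms(2) unfolding indep_def by blast
    fix k assume "k \<in> card ` Collect (indep M)"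
    then obtain J A where J: "k = card J" "J \<subseteq> A" "A \<in> bases M" by (auto simp: indep_def)
    have "finite A" using matroid_base_finite[OF assms(1) J(3)] .
    then show "k \<le> card B"
      using J matroid_base_card_le[OF assms(1) J(3) assms(2)] by (meson card_mono le_trans)
  qed
  then show ?thesis by (simp add: rank_def)
qed

lemma matroid_extend_into:
  assumes "matroid M" "indep M J" "B \<in> bases M"
  shows "\<exists>C\<in>bases M. J \<subseteq> C \<and> C \<subseteq> J \<union> B"
proof -
  from assms(2) obtain A where "A \<in> bases M" "J \<subseteq> A" by (auto simp: indep_def)
  then show ?thesis
  proof (induction "card (A - (J \<union> B))" arbitrary: A)
    case 0
    have "finite A" using matroid_base_finite[OF assms(1) 0(2)] .
    with 0(1) have "A \<subseteq> J \<union> B" by auto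
    with 0 show ?case by blast
  next
    case (Suc k)
    have fin: "finite A" using matroid_base_finite[OF assms(1) Suc(3)] .
    from Suc(2) have "A - (J \<union> B) \<noteq> {}" by (metis card.empty nat.simps(3))
    then obtain x where x: "x \<in> A" "x \<notin> J" "x \<notin> B" by auto
    with assms(1,3) Suc(3) obtain y where y: "y \<in> B - A" "insert y (A - {x}) \<in> bases M"
      unfolding matroid_def by (meson DiffI)
    have "insert y (A - {x}) - (J \<union> B) = (A - (J \<union> B)) - {x}" using y by auto
    then have "k = card (insert y (A - {x}) - (J \<union> B))" using x fin Suc(2) by simp
    moreover have "J \<subseteq> insert y (A - {x})" using x Suc(4) by auto
    ultimately show ?case using Suc(1) y(2) by blast
  qed
qed

lemma matroid_isthmus_ext:
  assumes M: "matroid M" and e: "e \<notin> ground M"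
  shows "matroid (isthmus_ext e M)"
proof -
  have bs: "bases (isthmus_ext e M) = insert e ` bases M"
    by (auto simp: isthmus_ext_def direct_sum_def isthmus_def)
  have gr: "ground (isthmus_ext e M) = insert e (ground M)"
    by (auto simp: isthmus_ext_def direct_sum_def isthmus_def)
  have ne: "e \<notin> A" if "A \<in> bases M" for A using that M e by (auto simp: matroid_def)
  have "\<exists>y\<in>insert e B - insert e A. insert y (insert e A - {x}) \<in> insert e ` bases M"
    if "A \<in> bases M" "B \<in> bases M" "x \<in> insert e A - insert e B" for A B x
  proof -
    from that have "x \<in> A - B" "x \<noteq> e" by auto
    with that M obtain y where y: "y \<in> B - A" "insert y (A - {x}) \<in> bases M"
      unfolding matroid_def by meson
    have "y \<noteq> e" using y ne that by auto
    moreover have "insert y (insert e A - {x}) = insert e (insert y (A - {x}))"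
      using \<open>x \<noteq> e\<close> by auto
    ultimately show ?thesis using y by blast
  qed
  then show ?thesis using M unfolding matroid_def bs gr by auto
qed

lemma matroid_principal_ext:
  assumes M: "matroid M" and e: "e \<notin> ground M"
  shows "matroid (principal_ext e M)"
proof -
  let ?N = "principal_ext e M"
  have bs: "bases ?N = bases M \<union> {insert e J | J. indep M J \<and> card J + 1 = rank M}"
    and gr: "ground ?N = insert e (ground M)"
    by (auto simp: principal_ext_def)
  have fin: "finite A" if "indep M A" for A
    using that matroid_base_finite[OF M] finite_subset unfolding indep_def by blast
  have ib: "indep M A" if "A \<in> bases M" for A using that by (auto simp: indep_def)
  have ne: "e \<notin> A" if "indep M A" for A using that M e by (auto simp: matroid_def indep_def)
  have sub: "indep M A" if "indep M B" "A \<subseteq> B" for A B using that by (auto simp: indep_def)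
  have exM: "\<exists>y\<in>B - A. insert y (A - {x}) \<in> bases M"
    if "A \<in> bases M" "B \<in> bases M" "x \<in> A - B" for A B x
    using that M unfolding matroid_def by meson
  have newI: "insert e J \<in> bases ?N" if "indep M J" "card J + 1 = rank M" for J
    using that bs by auto
  have ex: "\<exists>y\<in>B - A. insert y (A - {x}) \<in> bases ?N"
    if A: "A \<in> bases ?N" and B: "B \<in> bases ?N" and x: "x \<in> A - B" for A B x
  proof (cases "A \<in> bases M")
    case True
    show ?thesis
    proof (cases "B \<in> bases M")
      case B': True
      show ?thesis using exM[OF True B' x] bs by auto
    next
      case False
      then have "e \<in> B" using B bs by auto
      moreover have "indep M (A - {x})" using True sub[OF ib] by auto
      moreover have "card (A - {x}) + 1 = rank M"
        using matroid_base_card[OF M True] x fin[OF ib[OF True]]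
        by (metis DiffD1 Suc_eq_plus1 card.remove)
      ultimately show ?thesis using newI ne[OF ib[OF True]] by blast
    qed
  next
    case False
    then obtain J where J: "A = insert e J" "indep M J" "card J + 1 = rank M"
      using A bs by auto
    have eJ: "e \<notin> J" "finite J" using ne fin J by auto
    show ?thesis
    proof (cases "x = e")
      case True
      then have B': "B \<in> bases M" using x B bs by auto
      obtain C where C: "C \<in> bases M" "J \<subseteq> C" "C \<subseteq> J \<union> B"
        using matroid_extend_into[OF M J(2) B'] by auto
      have "card (C - J) = 1"
        using C(2) eJ J(3) matroid_base_card[OF M C(1)] by (simp add: card_Diff_subset)
      then obtain y where y: "C - J = {y}" by (rule card_1_singletonE)
      then have "C = insert y J" "y \<in> B" "y \<notin> J" using C by auto
      moreover have "y \<noteq> e" using ne[OF ib[OF B']] \<open>y \<in> B\<close> by auto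
      moreover have "A - {x} = J" using J True eJ by auto
      ultimately show ?thesis using C(1) J(1) bs by auto
    next
      case xe: False
      then have xJ: "x \<in> J" "x \<notin> B" using x J by auto
      have "\<exists>K. indep M K \<and> K \<subseteq> B \<and> rank M \<le> card K + 1 \<and> e \<notin> K"
      proof (cases "B \<in> bases M")
        case True
        then show ?thesis using ib ne matroid_base_card[OF M True] by (intro exI[of _ B]) auto
      next
        case False
        then show ?thesis using B bs ne by auto
      qed
      then obtain K where K: "indep M K" "K \<subseteq> B" "rank M \<le> card K + 1" "e \<notin> K" by auto
      obtain B' where B': "B' \<in> bases M" "K \<subseteq> B'" using K by (auto simp: indep_def)
      obtain C where C: "C \<in> bases M" "J - {x} \<subseteq> C" "C \<subseteq> (J - {x}) \<union> B'"
        using matroid_extend_into[OF M sub[OF J(2)] B'(1), of "J - {x}"] by auto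
      have finC: "finite C" "finite B'" "finite K" using fin ib C B' K by auto
      have cC: "card (C - (J - {x})) = 2"
      proof -
        have "card (J - {x}) + 1 = card J" using xJ eJ by (metis Suc_eq_plus1 card.remove)
        moreover have "card C = rank M" using matroid_base_card[OF M C(1)] .
        moreover have "card (C - (J - {x})) = card C - card (J - {x})"
          using C(2) eJ by (simp add: card_Diff_subset)
        ultimately show ?thesis using J(3) by linarith
      qed
      have "\<not> C - (J - {x}) \<subseteq> B' - K"
      proof
        assume "C - (J - {x}) \<subseteq> B' - K"
        then have "2 \<le> card (B' - K)" using cC finC by (metis card_mono finite_Diff)
        moreover have "card (B' - K) = rank M - card K"
          using B'(2) finC matroid_base_card[OF M B'(1)] by (simp add: card_Diff_subset)
        ultimately show False using K(3) by linarith
      qed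
      then obtain y where y: "y \<in> C" "y \<notin> J - {x}" "y \<in> K" using C(3) by auto
      have yn: "y \<in> B" "y \<noteq> x" "y \<noteq> e" "y \<notin> J" using y K xJ by auto
      have "indep M (insert y (J - {x}))" using C y by (auto simp: indep_def)
      moreover have "card (insert y (J - {x})) + 1 = rank M"
        using yn xJ eJ J(3) by (metis DiffD1 card.remove card_insert_disjoint finite_Diff)
      ultimately have "insert e (insert y (J - {x})) \<in> bases ?N" by (rule newI)
      moreover have "insert y (A - {x}) = insert e (insert y (J - {x}))" using J(1) xe by auto
      moreover have "y \<in> B - A" using yn J(1) by auto
      ultimately show ?thesis by metis
    qed
  qed
  have "bases ?N \<subseteq> Pow (ground ?N)"
    using M unfolding bs gr matroid_def indep_def by blast
  moreover have "finite (ground ?N)" "bases ?N \<noteq> {}"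
    using M unfolding matroid_def bs gr by simp_all
  ultimately show ?thesis using ex unfolding matroid_def[of ?N] by blast
qed

lemma matroid_string_matroid:
  "matroid (string_matroid \<sigma>) \<and> ground (string_matroid \<sigma>) = {..<length \<sigma>}"
proof (induction \<sigma> rule: rev_induct)
  case Nil
  show ?case by (simp add: string_matroid_def empty_matroid_def matroid_def)
next
  case (snoc s \<sigma>)
  have "string_matroid (\<sigma> @ [s]) =
     (if s = 0 then isthmus_ext (length \<sigma>) else principal_ext (length \<sigma>)) (string_matroid \<sigma>)"
    by (simp add: string_matroid_def enumerate_append_eq)
  moreover have "length \<sigma> \<notin> ground (string_matroid \<sigma>)" using snoc by simp
  then have "matroid (isthmus_ext (length \<sigma>) (string_matroid \<sigma>))"
    "matroid (principal_ext (length \<sigma>) (string_matroid \<sigma>))"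
    using matroid_isthmus_ext[OF conjunct1[OF snoc]] matroid_principal_ext[OF conjunct1[OF snoc]]
    by simp_all
  moreover have "ground (isthmus_ext (length \<sigma>) (string_matroid \<sigma>)) = {..<Suc (length \<sigma>)}"
    "ground (principal_ext (length \<sigma>) (string_matroid \<sigma>)) = {..<Suc (length \<sigma>)}"
    using conjunct2[OF snoc]
    by (simp_all add: isthmus_ext_def direct_sum_def isthmus_def principal_ext_def lessThan_Suc)
  ultimately show ?case by simp
qed


section \<open>Quasisymmetric functions\<close>

text \<open>
  A monomial in \<open>x\<^sub>1, x\<^sub>2, \<dots>\<close> is the finitely supported function \<open>m\<close> of its exponents, with
  \<open>0 \<notin> keys m\<close> since there is no variable \<open>x\<^sub>0\<close>; a formal power series is the function giving
  the coefficient of each monomial.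
\<close>

type_synonym monomial = "nat \<Rightarrow>\<^sub>0 nat"
type_synonym 'a pseries = "monomial \<Rightarrow> 'a"

definition mdeg :: "monomial \<Rightarrow> nat" where
  "mdeg m = (\<Sum>i\<in>Poly_Mapping.keys m. Poly_Mapping.lookup m i)"

text \<open>For \<open>p = [i\<^sub>1, \<dots>, i\<^sub>k]\<close> and \<open>a = [a\<^sub>1, \<dots>, a\<^sub>k]\<close>, the product of the \<open>x\<^bsub>i\<^sub>j\<^esub>\<close> raised to \<open>a\<^sub>j\<close>.\<close>

definition xmon :: "nat list \<Rightarrow> nat list \<Rightarrow> monomial" where
  "xmon p a = (\<Sum>j<length a. Poly_Mapping.single (p ! j) (a ! j))"

definition index_seq :: "nat \<Rightarrow> nat list \<Rightarrow> bool" where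
  "index_seq k p \<longleftrightarrow> length p = k \<and> sorted_wrt (<) p \<and> 0 \<notin> set p"

definition QSym :: "nat \<Rightarrow> ('a::comm_ring_1) pseries set" where
  "QSym n = {g.
     (\<forall>m. g m \<noteq> 0 \<longrightarrow> 0 \<notin> Poly_Mapping.keys m \<and> mdeg m = n) \<and>
     (\<forall>a p q. 0 \<notin> set a \<and> index_seq (length a) p \<and> index_seq (length a) q \<longrightarrow>
        g (xmon p a) = g (xmon q a))}"

definition pscale :: "'a::comm_ring_1 \<Rightarrow> 'a pseries \<Rightarrow> 'a pseries" where
  "pscale c g = (\<lambda>m. c * g m)"

global_interpretation pseries: vector_space "pscale :: 'a::field \<Rightarrow> 'a pseries \<Rightarrow> 'a pseries"
  by unfold_locales (auto simp: pscale_def fun_eq_iff algebra_simps)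

definition base_change :: "int pseries \<Rightarrow> ('a::comm_ring_1) pseries" where
  "base_change g = (\<lambda>m. of_int (g m))"

text \<open>
  The set \<open>QSym n\<close> with coefficients in a commutative ring, together with the bilinear map sending
  \<open>(g, c)\<close> to \<open>c\<close> times the base change of \<open>g\<close>, is a tensor product over the integers of
  the integral \<open>QSym n\<close> and that ring: it has the universal property, shown in
  \<open>QSym_tensor_exists\<close> and \<open>QSym_tensor_unique\<close>.
\<close>

definition comp_of :: "monomial \<Rightarrow> nat list" where
  "comp_of m = map (Poly_Mapping.lookup m) (sorted_list_of_set (Poly_Mapping.keys m))"

definition comps :: "nat \<Rightarrow> nat list set" where
  "comps n = {a. 0 \<notin> set a \<and> sum_list a = n}"

definition monoQ :: "nat list \<Rightarrow> ('a::comm_ring_1) pseries" where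
  "monoQ a = (\<lambda>m. if 0 \<notin> Poly_Mapping.keys m \<and> comp_of m = a then 1 else 0)"

definition rep_mon :: "nat list \<Rightarrow> monomial" where
  "rep_mon a = xmon [1..<Suc (length a)] a"

lemma lookup_xmon:
  "Poly_Mapping.lookup (xmon p a) k = (\<Sum>j<length a. if p ! j = k then a ! j else 0)"
  by (simp add: xmon_def lookup_sum lookup_single when_def)

lemma lookup_xmon_nth:
  assumes "distinct p" "length p = length a" "t < length a"
  shows "Poly_Mapping.lookup (xmon p a) (p ! t) = a ! t"
proof -
  have "(\<Sum>j<length a. if p ! j = p ! t then a ! j else 0) = (\<Sum>j<length a. if j = t then a ! j else 0)"
    using assms by (intro sum.cong) (auto simp: nth_eq_iff_index_eq)
  also have "\<dots> = a ! t" using assms by simp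
  finally show ?thesis by (simp only: lookup_xmon)
qed

lemma keys_xmon:
  assumes "distinct p" "length p = length a" "0 \<notin> set a"
  shows "Poly_Mapping.keys (xmon p a) = set p"
proof
  show "Poly_Mapping.keys (xmon p a) \<subseteq> set p"
  proof
    fix k assume "k \<in> Poly_Mapping.keys (xmon p a)"
    then have "(\<Sum>j<length a. if p ! j = k then a ! j else 0) \<noteq> 0"
      unfolding in_keys_iff lookup_xmon .
    then obtain j where "j < length a" "p ! j = k"
      by (auto elim!: sum.not_neutral_contains_not_neutral split: if_splits)
    then show "k \<in> set p" using assms(2) by auto
  qed
  show "set p \<subseteq> Poly_Mapping.keys (xmon p a)"
  proof
    fix k assume "k \<in> set p"
    then obtain t where t: "t < length a" "k = p ! t" using assms(2) by (auto simp: in_set_conv_nth)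
    then have "Poly_Mapping.lookup (xmon p a) k = a ! t" using lookup_xmon_nth[OF assms(1,2)] by simp
    then show "k \<in> Poly_Mapping.keys (xmon p a)" using t assms(3) by (metis in_keys_iff nth_mem)
  qed
qed

lemma index_seq_distinct: "index_seq k p \<Longrightarrow> distinct p"
  by (auto simp: index_seq_def strict_sorted_iff)

lemma comp_of_xmon:
  assumes "index_seq (length a) p" "0 \<notin> set a"
  shows "comp_of (xmon p a) = a" "0 \<notin> Poly_Mapping.keys (xmon p a)"
proof -
  have p: "distinct p" "length p = length a" "sorted p" "0 \<notin> set p"
    using assms index_seq_distinct by (auto simp: index_seq_def strict_sorted_iff)
  have "sorted_list_of_set (set p) = p" using p by (simp add: sorted_list_of_set.idem_if_sorted_distinct)
  then show "comp_of (xmon p a) = a"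
    using keys_xmon[OF p(1,2) assms(2)] lookup_xmon_nth[OF p(1,2)] p(2)
    by (auto simp: comp_of_def intro!: nth_equalityI)
  show "0 \<notin> Poly_Mapping.keys (xmon p a)" using keys_xmon[OF p(1,2) assms(2)] p by simp
qed

lemma xmon_comp_of:
  "xmon (sorted_list_of_set (Poly_Mapping.keys m)) (comp_of m) = m" (is "xmon ?p ?a = m")
proof (rule poly_mapping_eqI)
  fix k
  have nz: "0 \<notin> set ?a" by (auto simp: comp_of_def in_keys_iff)
  have len: "length ?p = length ?a" by (simp add: comp_of_def)
  have keys: "Poly_Mapping.keys (xmon ?p ?a) = Poly_Mapping.keys m"
    using keys_xmon[OF _ len nz] by simp
  show "Poly_Mapping.lookup (xmon ?p ?a) k = Poly_Mapping.lookup m k"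
  proof (cases "k \<in> Poly_Mapping.keys m")
    case True
    then have "k \<in> set ?p" by simp
    then obtain t where "t < length ?p" "k = ?p ! t" by (auto simp only: in_set_conv_nth)
    then show ?thesis using lookup_xmon_nth[OF _ len, of t] by (simp add: comp_of_def)
  next
    case False
    then show ?thesis using keys by (metis in_keys_iff)
  qed
qed

lemma index_seq_keys:
  assumes "0 \<notin> Poly_Mapping.keys m"
  shows "index_seq (length (comp_of m)) (sorted_list_of_set (Poly_Mapping.keys m))"
  using assms by (simp add: index_seq_def comp_of_def)

lemma comp_of_nonzero: "0 \<notin> set (comp_of m)"
  by (auto simp: comp_of_def in_keys_iff)

lemma sum_list_comp_of: "sum_list (comp_of m) = mdeg m"
  by (simp add: comp_of_def mdeg_def sum_list_distinct_conv_sum_set)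

lemma index_seq_upt: "index_seq k [1..<Suc k]"
  by (auto simp: index_seq_def strict_sorted_iff simp del: upt_Suc)

lemma comp_of_rep_mon:
  assumes "0 \<notin> set a"
  shows "comp_of (rep_mon a) = a" "0 \<notin> Poly_Mapping.keys (rep_mon a)"
  using comp_of_xmon[OF index_seq_upt assms] by (auto simp: rep_mon_def)

lemma finite_comps: "finite (comps n)"
proof -
  have "length a \<le> sum_list a" if "0 \<notin> set a" for a :: "nat list"
    using that by (induction a) auto
  then have "comps n \<subseteq> {a. set a \<subseteq> {..n} \<and> length a \<le> n}"
    by (auto simp: comps_def member_le_sum_list)
  then show ?thesis using finite_lists_length_le[of "{..n}" n] finite_subset by auto
qed

lemma QSym_I:
  assumes "\<And>m. g m \<noteq> 0 \<Longrightarrow> 0 \<notin> Poly_Mapping.keys m \<and> mdeg m = n"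
    and "\<And>a p q. 0 \<notin> set a \<Longrightarrow> index_seq (length a) p \<Longrightarrow> index_seq (length a) q \<Longrightarrow>
      g (xmon p a) = g (xmon q a)"
  shows "g \<in> QSym n"
  using assms unfolding QSym_def by blast

lemma QSym_D1: "g \<in> QSym n \<Longrightarrow> g m \<noteq> 0 \<Longrightarrow> 0 \<notin> Poly_Mapping.keys m \<and> mdeg m = n"
  unfolding QSym_def by blast

lemma QSym_D2:
  "g \<in> QSym n \<Longrightarrow> 0 \<notin> set a \<Longrightarrow> index_seq (length a) p \<Longrightarrow> index_seq (length a) q \<Longrightarrow>
    g (xmon p a) = g (xmon q a)"
  unfolding QSym_def by blast

lemma QSym_rep_mon:
  assumes "g \<in> QSym n" "0 \<notin> Poly_Mapping.keys m"
  shows "g m = g (rep_mon (comp_of m))"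
proof -
  have "g (xmon (sorted_list_of_set (Poly_Mapping.keys m)) (comp_of m)) = g (rep_mon (comp_of m))"
    unfolding rep_mon_def
    by (rule QSym_D2[OF assms(1) comp_of_nonzero index_seq_keys[OF assms(2)] index_seq_upt])
  then show ?thesis by (simp only: xmon_comp_of)
qed

lemma monoQ_QSym:
  assumes a: "a \<in> comps n"
  shows "monoQ a \<in> QSym n"
proof (rule QSym_I)
  fix m assume "monoQ a m \<noteq> 0"
  then have "0 \<notin> Poly_Mapping.keys m" "comp_of m = a" by (auto simp: monoQ_def split: if_splits)
  then show "0 \<notin> Poly_Mapping.keys m \<and> mdeg m = n"
    using a sum_list_comp_of[of m] by (simp add: comps_def)
next
  fix b p q :: "nat list" assume "0 \<notin> set b" "index_seq (length b) p" "index_seq (length b) q"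
  then show "monoQ a (xmon p b) = monoQ a (xmon q b)"
    by (simp add: monoQ_def comp_of_xmon)
qed

lemma sum_fun_apply: "(\<Sum>a\<in>A. F a) m = (\<Sum>a\<in>A. F a m)" for F :: "'b \<Rightarrow> 'c \<Rightarrow> 'd::comm_monoid_add"
  by (induction A rule: infinite_finite_induct) auto

lemma QSym_expand:
  assumes "g \<in> QSym n"
  shows "g = (\<Sum>a\<in>comps n. pscale (g (rep_mon a)) (monoQ a))"
proof
  fix m
  have "(\<Sum>a\<in>comps n. pscale (g (rep_mon a)) (monoQ a)) m =
     (\<Sum>a\<in>comps n. if a = comp_of m then (if 0 \<notin> Poly_Mapping.keys m then g (rep_mon a) else 0) else 0)"
    unfolding sum_fun_apply by (intro sum.cong) (auto simp: pscale_def monoQ_def)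
  also have "\<dots> = (if comp_of m \<in> comps n \<and> 0 \<notin> Poly_Mapping.keys m then g (rep_mon (comp_of m)) else 0)"
    using finite_comps by simp
  also have "\<dots> = g m"
  proof (cases "comp_of m \<in> comps n \<and> 0 \<notin> Poly_Mapping.keys m")
    case True
    then show ?thesis using QSym_rep_mon[OF assms] by simp
  next
    case False
    then have "g m = 0"
      using QSym_D1[OF assms, of m] comp_of_nonzero[of m] sum_list_comp_of[of m]
      by (auto simp: comps_def)
    then show ?thesis using False by auto
  qed
  finally show "g m = (\<Sum>a\<in>comps n. pscale (g (rep_mon a)) (monoQ a)) m" by simp
qed

lemma QSym_0: "0 \<in> QSym n"
  by (rule QSym_I) simp_all

lemma QSym_add:
  assumes "g \<in> QSym n" "h \<in> QSym n"
  shows "g + h \<in> QSym n"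
proof (rule QSym_I)
  fix m assume "(g + h) m \<noteq> 0"
  then have "g m \<noteq> 0 \<or> h m \<noteq> 0" by auto
  then show "0 \<notin> Poly_Mapping.keys m \<and> mdeg m = n" using assms QSym_D1 by blast
next
  fix a p q :: "nat list" assume "0 \<notin> set a" "index_seq (length a) p" "index_seq (length a) q"
  then show "(g + h) (xmon p a) = (g + h) (xmon q a)"
    using QSym_D2[OF assms(1), of a p q] QSym_D2[OF assms(2), of a p q] by simp
qed

lemma QSym_scale:
  assumes "g \<in> QSym n"
  shows "pscale c g \<in> QSym n"
proof (rule QSym_I)
  fix m assume "pscale c g m \<noteq> 0"
  then have "g m \<noteq> 0" by (auto simp: pscale_def)
  then show "0 \<notin> Poly_Mapping.keys m \<and> mdeg m = n" using assms QSym_D1 by blast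
next
  fix a p q :: "nat list" assume "0 \<notin> set a" "index_seq (length a) p" "index_seq (length a) q"
  then show "pscale c g (xmon p a) = pscale c g (xmon q a)"
    using QSym_D2[OF assms, of a p q] by (simp add: pscale_def)
qed

lemma base_change_QSym:
  assumes "g \<in> QSym n"
  shows "base_change g \<in> (QSym n :: ('a::comm_ring_1) pseries set)"
proof (rule QSym_I)
  fix m assume "base_change g m \<noteq> (0::'a)"
  then have "g m \<noteq> 0" by (auto simp: base_change_def)
  then show "0 \<notin> Poly_Mapping.keys m \<and> mdeg m = n" using assms QSym_D1 by blast
next
  fix a p q :: "nat list" assume "0 \<notin> set a" "index_seq (length a) p" "index_seq (length a) q"
  then show "base_change g (xmon p a) = (base_change g (xmon q a) :: 'a)"
    using QSym_D2[OF assms, of a p q] by (simp add: base_change_def)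
qed

lemma additive_on_sum:
  fixes \<phi> :: "('a::comm_ring_1) pseries \<Rightarrow> 'w::ab_group_add"
  assumes add: "\<And>g h. g \<in> QSym n \<Longrightarrow> h \<in> QSym n \<Longrightarrow> \<phi> (g + h) = \<phi> g + \<phi> h"
    and "finite A" "\<And>a. a \<in> A \<Longrightarrow> F a \<in> QSym n"
  shows "(\<Sum>a\<in>A. F a) \<in> QSym n \<and> \<phi> (\<Sum>a\<in>A. F a) = (\<Sum>a\<in>A. \<phi> (F a))"
  using assms(2,3)
proof (induction A rule: finite_induct)
  case empty
  have "\<phi> 0 = 0" using add[OF QSym_0 QSym_0] by simp
  then show ?case by (simp only: sum.empty QSym_0 simp_thms)
next
  case (insert x A)
  then have "F x \<in> QSym n" "sum F A \<in> QSym n" "\<phi> (sum F A) = (\<Sum>a\<in>A. \<phi> (F a))" by simp_all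
  then show ?case using add[of "F x" "sum F A"] QSym_add[of "F x" n "sum F A"]
    by (simp only: sum.insert[OF insert(1,2)] simp_thms)
qed

lemma additive_int_scale:
  fixes \<alpha> :: "int \<Rightarrow> 'w::ab_group_add" and \<beta> :: "int \<Rightarrow> 'w"
  assumes "\<And>k l. \<alpha> (k + l) = \<alpha> k + \<alpha> l" "\<And>k l. \<beta> (k + l) = \<beta> k + \<beta> l" "\<alpha> 1 = \<beta> 1"
  shows "\<alpha> k = \<beta> k"
proof (induction k rule: int_induct[where k = 0])
  case base
  show ?case using assms(1)[of 0 0] assms(2)[of 0 0] by simp
next
  case (step1 i)
  then show ?case using assms by simp
next
  case (step2 i)
  then show ?case using assms(1)[of "i - 1" 1] assms(2)[of "i - 1" 1] assms(3) by simp
qed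

theorem QSym_tensor_exists:
  fixes \<beta> :: "int pseries \<Rightarrow> 'a::comm_ring_1 \<Rightarrow> 'w::ab_group_add"
  assumes addl: "\<And>g h c. g \<in> QSym n \<Longrightarrow> h \<in> QSym n \<Longrightarrow> \<beta> (g + h) c = \<beta> g c + \<beta> h c"
    and addr: "\<And>g c d. g \<in> QSym n \<Longrightarrow> \<beta> g (c + d) = \<beta> g c + \<beta> g d"
  shows "\<exists>\<phi> :: 'a pseries \<Rightarrow> 'w.
    (\<forall>g\<in>QSym n. \<forall>h\<in>QSym n. \<phi> (g + h) = \<phi> g + \<phi> h) \<and>
    (\<forall>g\<in>QSym n. \<forall>c. \<phi> (pscale c (base_change g)) = \<beta> g c)"
proof (intro exI conjI ballI allI)
  let ?\<phi> = "\<lambda>g :: 'a pseries. \<Sum>a\<in>comps n. \<beta> (monoQ a) (g (rep_mon a))"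
  show "?\<phi> (g + h) = ?\<phi> g + ?\<phi> h" for g h
    by (simp add: addr monoQ_QSym sum.distrib)
  fix g :: "int pseries" and c :: 'a
  assume g: "g \<in> QSym n"
  have "\<beta> (monoQ a) (c * of_int k) = \<beta> (pscale k (monoQ a)) c" if a: "a \<in> comps n" for a k
  proof (rule additive_int_scale[where \<alpha> = "\<lambda>k. \<beta> (monoQ a) (c * of_int k)"])
    note q = monoQ_QSym[OF a]
    show "\<beta> (monoQ a) (c * of_int (k + l)) = \<beta> (monoQ a) (c * of_int k) + \<beta> (monoQ a) (c * of_int l)"
      for k l by (simp add: ring_distribs addr[OF q])
    have "pscale (k + l) (monoQ a) = pscale k (monoQ a) + pscale l (monoQ a)" for k l :: int
      by (auto simp: pscale_def ring_distribs)
    then show "\<beta> (pscale (k + l) (monoQ a)) c = \<beta> (pscale k (monoQ a)) c + \<beta> (pscale l (monoQ a)) c"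
      for k l by (simp add: addl QSym_scale[OF q])
    show "\<beta> (monoQ a) (c * of_int 1) = \<beta> (pscale 1 (monoQ a)) c"
      by (simp add: pscale_def)
  qed
  then have "?\<phi> (pscale c (base_change g)) = (\<Sum>a\<in>comps n. \<beta> (pscale (g (rep_mon a)) (monoQ a)) c)"
    by (intro sum.cong) (auto simp: pscale_def base_change_def)
  also have "\<dots> = \<beta> (\<Sum>a\<in>comps n. pscale (g (rep_mon a)) (monoQ a)) c"
    by (rule additive_on_sum[of n "\<lambda>h. \<beta> h c", THEN conjunct2, symmetric])
      (auto simp: addl finite_comps QSym_scale monoQ_QSym)
  also have "\<dots> = \<beta> g c" by (simp only: QSym_expand[OF g, symmetric])
  finally show "?\<phi> (pscale c (base_change g)) = \<beta> g c" .
qed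

theorem QSym_tensor_unique:
  fixes \<phi> \<psi> :: "('a::comm_ring_1) pseries \<Rightarrow> 'w::ab_group_add"
  assumes "\<And>g h. g \<in> QSym n \<Longrightarrow> h \<in> QSym n \<Longrightarrow> \<phi> (g + h) = \<phi> g + \<phi> h"
    and "\<And>g h. g \<in> QSym n \<Longrightarrow> h \<in> QSym n \<Longrightarrow> \<psi> (g + h) = \<psi> g + \<psi> h"
    and eq: "\<And>g c. g \<in> QSym n \<Longrightarrow> \<phi> (pscale c (base_change g)) = \<psi> (pscale c (base_change g))"
    and h: "h \<in> QSym n"
  shows "\<phi> h = \<psi> h"
proof -
  let ?F = "\<lambda>a. pscale (h (rep_mon a)) (monoQ a)"
  have F: "?F a \<in> QSym n" if "a \<in> comps n" for a using that QSym_scale monoQ_QSym by blast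
  have "base_change (monoQ a) = (monoQ a :: 'a pseries)" for a
    by (auto simp: monoQ_def base_change_def)
  then have "\<phi> (?F a) = \<psi> (?F a)" if "a \<in> comps n" for a
    using eq[OF monoQ_QSym[OF that], of "h (rep_mon a)"] by simp
  then have "\<phi> (\<Sum>a\<in>comps n. ?F a) = \<psi> (\<Sum>a\<in>comps n. ?F a)"
    using additive_on_sum[of n \<phi>, OF assms(1) finite_comps F]
      additive_on_sum[of n \<psi>, OF assms(2) finite_comps F] by simp
  then show ?thesis by (simp only: QSym_expand[OF h, symmetric])
qed


section \<open>The quasisymmetric function of a matroid\<close>

definition generic :: "'a base_system \<Rightarrow> ('a \<Rightarrow> nat) \<Rightarrow> bool" where
  "generic M f \<longleftrightarrow> (\<exists>!B. B \<in> bases M \<and> (\<forall>B'\<in>bases M. sum f B \<le> sum f B'))"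

definition matroid_qsym :: "'a base_system \<Rightarrow> int pseries" where
  "matroid_qsym M = (\<lambda>m. int (card {f \<in> ground M \<rightarrow>\<^sub>E {1..}.
     generic M f \<and> (\<Sum>e\<in>ground M. Poly_Mapping.single (f e) 1) = m}))"

text \<open>The coefficients are cardinalities of finite sets.\<close>

lemma finite_matroid_qsym_fibre:
  assumes "finite (ground M)"
  shows "finite {f \<in> ground M \<rightarrow>\<^sub>E {1..}.
     generic M f \<and> (\<Sum>e\<in>ground M. Poly_Mapping.single (f e) (1::nat)) = m}" (is "finite ?S")
proof -
  have "?S \<subseteq> ground M \<rightarrow>\<^sub>E Poly_Mapping.keys m"
  proof
    fix f assume f: "f \<in> ?S"
    have "f e \<in> Poly_Mapping.keys m" if e: "e \<in> ground M" for e
    proof -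
      have "Poly_Mapping.lookup m (f e) = (\<Sum>d\<in>ground M. Poly_Mapping.lookup (Poly_Mapping.single (f d) (1::nat)) (f e))"
        using f by (auto simp: lookup_sum)
      also have "\<dots> \<ge> Poly_Mapping.lookup (Poly_Mapping.single (f e) (1::nat)) (f e)"
        using assms e by (intro member_le_sum) auto
      finally show ?thesis by (simp add: in_keys_iff)
    qed
    then show "f \<in> ground M \<rightarrow>\<^sub>E Poly_Mapping.keys m" using f by (auto simp: PiE_iff)
  qed
  then show ?thesis using assms by (meson finite_PiE finite_keys finite_subset)
qed

end

theory Submission
  imports Defs "HOL-Combinatorics.Multiset_Permutations"
begin

text \<open>
  For an ordering \<open>p\<close> of the ground set let \<open>w(p)\<close> be the binary word recording at which elements of
  \<open>p\<close> the rank jumps. If \<open>f\<close> is sorted along \<open>p\<close>, then the jump positions form a base of minimal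
  \<open>f\<close>-weight, and \<open>f\<close> is generic as soon as all non-jumps precede all jumps within each level of
  \<open>f\<close>. A generic \<open>f\<close> is reached by exactly \<open>\<Prod> l\<^sub>i! c\<^sub>i!\<close> such orderings, where its \<open>i\<close>-th level has
  \<open>l\<^sub>i\<close> non-jumps and \<open>c\<^sub>i\<close> jumps. Hence, when \<open>n!\<close> is invertible, \<open>F(M)\<close> is the sum over all orderings of
  \<open>\<psi>(w(p))\<close>, where \<open>\<psi>(w)\<close> is the sum over all factorisations of \<open>w\<close> into words \<open>0\<^sup>l 1\<^sup>c\<close> of
  \<open>\<Prod> 1 / (l\<^sub>i! c\<^sub>i!)\<close> times the monomial quasisymmetric function of the factor lengths.

  For \<open>M\<^sub>\<sigma>\<close> every word \<open>w(p)\<close> dominates the complement of \<open>\<sigma>\<close>, and that complement itself occurs a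
  number of times that is a product of factorials. By triangularity a linear form vanishing on all
  \<open>F(M\<^sub>\<sigma>)\<close> vanishes on \<open>\<psi>(w)\<close> for each \<open>w\<close> starting with 1.

  Dually to \<open>\<psi>\<close>, such a form is an element of the algebra generated by the homogeneous parts of
  \<open>exp x exp y\<close> in noncommuting \<open>x\<close>, \<open>y\<close> having no monomial that starts with \<open>y\<close>. Expanding
  elements of this algebra on the left by the parts of \<open>exp x exp y\<close>, or by those of
  \<open>exp y exp x\<close>, one shows by a simultaneous induction on the degree that an element of positive
  degree with no monomial starting with \<open>y\<close> is zero, and likewise for \<open>x\<close>.
\<close>


section \<open>Words and compositions\<close>

abbreviation (input) fct :: "nat \<Rightarrow> 'a::field" where
  "fct k \<equiv> of_nat (fact k)"

text \<open>The coefficient of the word \<open>u\<close> in exp x exp y, where y is the letter other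
  than \<open>x\<close>. Thus \<open>block_weight False\<close> and \<open>block_weight True\<close>
  belong to the two orders of the factors.\<close>

definition block_weight :: "bool \<Rightarrow> bool list \<Rightarrow> 'a::field" where
  "block_weight x u =
     (if u = replicate (count_list u x) x @ replicate (count_list u (\<not> x)) (\<not> x)
      then 1 / (fct (count_list u x) * fct (count_list u (\<not> x))) else 0)"

lemma count_list_replicate: "count_list (replicate n x) y = (if x = y then n else 0)"
  by (induction n) auto

lemma block_weight_replicate:
  "block_weight x (replicate l x @ replicate c (\<not> x)) = 1 / (fct l * fct c)"
  by (simp add: block_weight_def count_list_replicate)

lemma block_weight_replicate_not: "block_weight x (replicate c (\<not> x)) = 1 / fct c"
  using block_weight_replicate[of x 0 c] by simp

lemma block_weight_replicate_same: "block_weight x (replicate l x) = 1 / fct l"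
  using block_weight_replicate[of x l 0] by simp

lemma block_weight_Nil [simp]: "block_weight x [] = 1"
  using block_weight_replicate[of x 0 0] by simp

lemma block_weight_nonzeroE:
  assumes "block_weight x u \<noteq> 0"
  obtains l c where "u = replicate l x @ replicate c (\<not> x)"
  using assms unfolding block_weight_def by metis

text \<open>A word x^l y^c that is nonempty and starts with y has l = 0, so only pure powers of y
  survive. Later this isolates a single first block.\<close>

lemma block_weight_start_not:
  assumes "u \<noteq> []" "hd u = (\<not> x)"
  shows "(block_weight x u :: 'a::field) = (if u = replicate (length u) (\<not> x) then 1 / fct (length u) else 0)"
proof (cases "block_weight x u = (0::'a)")
  case True
  then show ?thesis
    using block_weight_replicate_not[of x "length u", where 'a='a] by (smt (verit, best))
next
  case False
  then obtain l c where u: "u = replicate l x @ replicate c (\<not> x)"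
    by (rule block_weight_nonzeroE)
  with assms have "l = 0" by (cases l) auto
  with u show ?thesis by (simp add: block_weight_replicate_not)
qed

lemma fact_nonzero_le:
  assumes "fct n \<noteq> (0::'a::field)" "k \<le> n"
  shows "fct k \<noteq> (0::'a)"
proof
  assume zero: "fct k = (0::'a)"
  obtain d where "fact n = fact k * (d::nat)"
    using fact_dvd[OF assms(2)] by (rule dvdE)
  then have "fct n = fct k * (of_nat d :: 'a)" by (simp only: of_nat_mult)
  with zero assms(1) show False by simp
qed

text \<open>Multiplied by b!, the sum becomes the alternating sum of the binomial coefficients of
  \<open>b\<close>, which is 0 for \<open>b > 0\<close>.\<close>

lemma alternating_inverse_fact_sum:
  assumes "fct b \<noteq> (0::'a::field)" "b > 0"
  shows "(\<Sum>j\<le>b. (- 1) ^ j / (fct j * fct (b - j))) = (0::'a)"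
proof -
  have "(- 1) ^ j / (fct j * fct (b - j)) = (- 1) ^ j * of_nat (b choose j) / (fct b :: 'a)"
    if "j \<le> b" for j
  proof -
    have "(of_nat (fact j * fact (b - j) * (b choose j)) :: 'a) = of_nat (fact b)"
      using binomial_fact_lemma[OF that] by simp
    then have "fct j * fct (b - j) * of_nat (b choose j) = (fct b :: 'a)"
      by simp
    moreover have "fct j \<noteq> (0::'a)" "fct (b - j) \<noteq> (0::'a)"
      using fact_nonzero_le[OF assms(1)] that by simp_all
    ultimately show ?thesis using assms(1) by (simp add: field_simps)
  qed
  then have "(\<Sum>j\<le>b. (- 1) ^ j / (fct j * fct (b - j)))
      = (\<Sum>j\<le>b. (- 1) ^ j * of_nat (b choose j)) / (fct b :: 'a)"
    by (simp add: sum_divide_distrib)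
  then show ?thesis using choose_alternating_sum[OF assms(2), where 'a='a] by simp
qed

text \<open>Coefficientwise form of \<open>exp (-y) exp (-x) exp x exp y = 1\<close> in noncommuting variables, with
  \<open>x\<close>, \<open>y\<close> standing for the letters \<open>False\<close>, \<open>True\<close>.\<close>

lemma block_weight_inverse:
  assumes "fct (length u) \<noteq> (0::'a::field)" "u \<noteq> []"
  shows "(\<Sum>k\<le>length u. (- 1) ^ k * block_weight True (take k u) * block_weight False (drop k u)) = (0::'a)"
    (is "sum ?t _ = 0")
proof (cases "\<exists>k\<le>length u. ?t k \<noteq> 0")
  case False
  then show ?thesis by (intro sum.neutral) auto
next
  case True
  \<comment> \<open>One nonzero summand already fixes the shape of \<open>u\<close> as 1^a 0^b 1^c,
    with 0 for \<open>False\<close> and 1 for \<open>True\<close>; all summands are then computed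
    from this shape.\<close>
  then obtain k where k: "k \<le> length u" "block_weight True (take k u) \<noteq> (0::'a)"
      "block_weight False (drop k u) \<noteq> (0::'a)" by auto
  obtain a b1 where t: "take k u = replicate a True @ replicate b1 False"
    using block_weight_nonzeroE[OF k(2)] by auto
  obtain b2 c where d: "drop k u = replicate b2 False @ replicate c True"
    using block_weight_nonzeroE[OF k(3)] by auto
  define b where "b = b1 + b2"
  have u: "u = replicate a True @ replicate b False @ replicate c True"
    using t d append_take_drop_id[of k u] by (simp add: b_def replicate_add)
  \<comment> \<open>For \<open>b = 0\<close> the word is a power of \<open>True\<close> and every
    split point contributes; otherwise only the split points from \<open>a\<close> to
    \<open>a + b\<close> do. Both cases end in the alternating factorial sum.\<close>
  show ?thesis
  proof (cases "b = 0")
    case True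
    define m where "m = length u"
    have um: "u = replicate m True" using u True by (simp add: m_def flip: replicate_add)
    have "?t j = (- 1) ^ j / (fct j * fct (m - j))" if "j \<le> m" for j
      using that block_weight_replicate_same[of True j, where 'a='a]
        block_weight_replicate_not[of False "m - j", where 'a='a]
      by (simp add: um min_def)
    then have "sum ?t {..m} = (\<Sum>j\<le>m. (- 1) ^ j / (fct j * fct (m - j)))" by simp
    also have "\<dots> = 0"
      by (rule alternating_inverse_fact_sum) (use assms m_def in auto)
    finally show ?thesis by (simp add: m_def)
  next
    case False
    have len: "length u = a + b + c" by (simp add: u)
    have z1: "block_weight False (drop j u) = (0::'a)" if "j < a" for j
    proof (rule ccontr)
      assume "\<not> ?thesis"
      then obtain p q where "drop j u = replicate p False @ replicate q True"
        using block_weight_nonzeroE by (metis (full_types))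
      moreover have "drop j u = replicate (a - j) True @ replicate b False @ replicate c True"
        using that by (simp add: u)
      ultimately have eq: "replicate p False @ replicate q True =
          replicate (a - j) True @ replicate b False @ replicate c True" by simp
      then have "p = 0" using that by (cases p; cases "a - j") auto
      with eq have "False \<notin> set (replicate (a - j) True @ replicate b False @ replicate c True)"
        by (metis append_Nil in_set_replicate replicate_0)
      with False show False by auto
    qed
    have z2: "block_weight True (take j u) = (0::'a)" if "a + b < j" "j \<le> length u" for j
    proof (rule ccontr)
      assume "\<not> ?thesis"
      then obtain p q where "take j u = replicate p True @ replicate q False"
        using block_weight_nonzeroE by (metis (full_types))
      moreover have "take j u = replicate a True @ replicate b False @ replicate (j - a - b) True"
        using that by (auto simp: u min_def)
      ultimately have eq: "replicate p True @ replicate q False =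
          replicate a True @ replicate b False @ replicate (j - a - b) True" by simp
      have "rev (replicate p True @ replicate q False) =
          rev (replicate a True @ replicate b False @ replicate (j - a - b) True)" by (simp only: eq)
      then have "replicate q False @ replicate p True =
          replicate (j - a - b) True @ replicate b False @ replicate a True"
        by (simp add: rev_append)
      then have "q = 0" using that by (cases q; cases "j - a - b") auto
      with eq have "False \<notin> set (replicate a True @ replicate b False @ replicate (j - a - b) True)"
        by (metis append_Nil2 in_set_replicate replicate_0)
      with False show False by auto
    qed
    have mid: "?t (a + j) = (- 1) ^ a / (fct a * fct c) * ((- 1) ^ j / (fct j * fct (b - j)))"
      if "j \<le> b" for j
    proof -
      have "take (a + j) u = replicate a True @ replicate j False"
        "drop (a + j) u = replicate (b - j) False @ replicate c True"
        using that by (simp_all add: u min_def)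
      then show ?thesis
        using block_weight_replicate[of True a j, where 'a='a]
          block_weight_replicate[of False "b - j" c, where 'a='a]
        by (simp add: power_add)
    qed
    have "sum ?t {..length u} = sum ?t {a..a + b}"
      by (rule sum.mono_neutral_right) (use z1 z2 len in \<open>auto simp: not_le\<close>)
    also have "\<dots> = (\<Sum>j\<le>b. ?t (a + j))"
      using sum.shift_bounds_cl_nat_ivl[of ?t 0 a b]
      by (simp add: atMost_atLeast0 add.commute)
    also have "\<dots> = (\<Sum>j\<le>b. (- 1) ^ a / (fct a * fct c) * ((- 1) ^ j / (fct j * fct (b - j))))"
      by (rule sum.cong[OF refl]) (use mid in auto)
    also have "\<dots> = (- 1) ^ a / (fct a * fct c) * (\<Sum>j\<le>b. (- 1) ^ j / (fct j * fct (b - j)))"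
      by (simp only: sum_distrib_left)
    also have "\<dots> = 0"
      using alternating_inverse_fact_sum[of b, where 'a='a] fact_nonzero_le[OF assms(1), of b] False len
      by simp
    finally show ?thesis .
  qed
qed

section \<open>Products of homogeneous parts, indexed by compositions\<close>

text \<open>The coefficient of \<open>monoQ a\<close> in \<psi>(w), or equivalently of
  \<open>w\<close> in the product of the parts of exp x exp y of degrees \<open>a\<close>. It has
  this meaning only if \<open>length w = sum_list a\<close>, since \<open>take\<close> truncates
  silently.\<close>

primrec comp_weight :: "nat list \<Rightarrow> bool list \<Rightarrow> 'a::field" where
  "comp_weight [] w = (if w = [] then 1 else 0)"
| "comp_weight (k # a) w = block_weight False (take k w) * comp_weight a (drop k w)"

text \<open>The value on \<psi>(w) of the linear form that sends \<open>monoQ a\<close> to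
  \<open>c a\<close>. Dually, the coefficient of \<open>w\<close> in the combination, with
  coefficients \<open>c\<close>, of the products of homogeneous parts.\<close>

definition word_eval :: "nat \<Rightarrow> (nat list \<Rightarrow> 'a::field) \<Rightarrow> bool list \<Rightarrow> 'a" where
  "word_eval n c w = (\<Sum>a\<in>comps n. c a * comp_weight a w)"

lemma comps_0: "comps 0 = {[]}"
proof -
  have "a = []" if "0 \<notin> set a" "sum_list a = 0" for a :: "nat list"
    using that by (cases a) auto
  then show ?thesis by (auto simp: comps_def)
qed

lemma comps_decomp:
  assumes "n \<ge> 1"
  shows "comps n = (\<Union>k\<in>{1..n}. (#) k ` comps (n - k))"
proof
  show "comps n \<subseteq> (\<Union>k\<in>{1..n}. (#) k ` comps (n - k))"
  proof
    fix a assume a: "a \<in> comps n"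
    with assms obtain k b where "a = k # b" by (cases a) (auto simp: comps_def)
    moreover from this a have "k \<in> {1..n}" "b \<in> comps (n - k)" by (auto simp: comps_def)
    ultimately show "a \<in> (\<Union>k\<in>{1..n}. (#) k ` comps (n - k))" by blast
  qed
qed (auto simp: comps_def)

lemma word_eval_0: "word_eval 0 c [] = c []"
  by (simp add: word_eval_def comps_0)

lemma word_eval_first_block:
  assumes "n \<ge> 1"
  shows "word_eval n c w =
    (\<Sum>k=1..n. block_weight False (take k w) * word_eval (n - k) (\<lambda>a. c (k # a)) (drop k w))"
proof -
  have "word_eval n c w = (\<Sum>k=1..n. \<Sum>a\<in>(#) k ` comps (n - k). c a * comp_weight a w)"
    unfolding word_eval_def comps_decomp[OF assms]
    by (rule sum.UNION_disjoint) (auto simp: finite_comps)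
  also have "\<dots> = (\<Sum>k=1..n. block_weight False (take k w) * word_eval (n - k) (\<lambda>a. c (k # a)) (drop k w))"
    by (rule sum.cong[OF refl])
      (simp add: sum.reindex inj_on_def word_eval_def sum_distrib_left mult.left_commute)
  finally show ?thesis .
qed

text \<open>The word functions agreeing in length \<open>n\<close> with some \<open>word_eval n c\<close> form the degree \<open>n\<close> part of
  the subalgebra generated by the homogeneous parts of \<open>exp x exp y\<close>.\<close>

definition representable :: "nat \<Rightarrow> (bool list \<Rightarrow> 'a::field) \<Rightarrow> bool" where
  "representable n g \<longleftrightarrow> (\<exists>c. \<forall>w. length w = n \<longrightarrow> g w = word_eval n c w)"

lemma representable_word_eval: "representable n (word_eval n c)"
  unfolding representable_def by blast

lemma representable_0: "representable n (\<lambda>_. 0)"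
  unfolding representable_def by (rule exI[of _ "\<lambda>_. 0"]) (simp add: word_eval_def)

lemma representable_add:
  assumes "representable n g" "representable n h"
  shows "representable n (\<lambda>w. g w + h w)"
proof -
  obtain c d where "\<forall>w. length w = n \<longrightarrow> g w = word_eval n c w"
    "\<forall>w. length w = n \<longrightarrow> h w = word_eval n d w" using assms unfolding representable_def by blast
  then show ?thesis unfolding representable_def
    by (intro exI[of _ "\<lambda>a. c a + d a"]) (simp add: word_eval_def algebra_simps sum.distrib)
qed

lemma representable_scale:
  assumes "representable n g"
  shows "representable n (\<lambda>w. r * g w)"
proof -
  obtain c where "\<forall>w. length w = n \<longrightarrow> g w = word_eval n c w"
    using assms unfolding representable_def by blast
  then show ?thesis unfolding representable_def
    by (intro exI[of _ "\<lambda>a. r * c a"]) (simp add: word_eval_def sum_distrib_left mult.assoc)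
qed

lemma representable_sum:
  assumes "\<And>i. i \<in> I \<Longrightarrow> representable n (g i)"
  shows "representable n (\<lambda>w. \<Sum>i\<in>I. g i w)"
  using assms
  by (induction I rule: infinite_finite_induct) (simp_all add: representable_0 representable_add)

text \<open>Left multiplication by the part of degree \<open>k\<close> moves the coefficient of each
  composition \<open>a\<close> to \<open>k # a\<close>. For \<open>k = 0\<close> the factor is
  1.\<close>

lemma representable_prepend:
  assumes "representable (n - k) g" "k \<le> n"
  shows "representable n (\<lambda>w. block_weight False (take k w) * g (drop k w))"
proof (cases "k = 0")
  case False
  obtain c where c: "\<And>w. length w = n - k \<Longrightarrow> g w = word_eval (n - k) c w"
    using assms unfolding representable_def by blast
  define d where "d a = (if a \<noteq> [] \<and> hd a = k then c (tl a) else 0)" for a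
  have "block_weight False (take k w) * g (drop k w) = word_eval n d w" if "length w = n" for w
  proof -
    have "word_eval (n - j) (\<lambda>a. d (j # a)) v = (if j = k then word_eval (n - k) c v else 0)" for j v
      by (simp add: d_def word_eval_def)
    then have summand: "block_weight False (take j w) * word_eval (n - j) (\<lambda>a. d (j # a)) (drop j w) =
        (if j = k then block_weight False (take k w) * word_eval (n - k) c (drop k w) else 0)" for j
      by simp
    have "word_eval n d w =
        (\<Sum>j=1..n. if j = k then block_weight False (take k w) * word_eval (n - k) c (drop k w) else 0)"
      using False assms by (subst word_eval_first_block) (simp_all only: summand)
    then show ?thesis using c[of "drop k w"] that False assms by simp
  qed
  then show ?thesis unfolding representable_def by blast
qed (use assms in simp)

section \<open>Left expansions by first blocks, in either order of the letters\<close>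

lemma representable_decomp_False:
  assumes "representable n g" "n \<ge> 1"
  shows "\<exists>h. (\<forall>k\<in>{1..n}. representable (n - k) (h k)) \<and>
    (\<forall>w. length w = n \<longrightarrow> g w = (\<Sum>k=1..n. block_weight False (take k w) * h k (drop k w)))"
proof -
  obtain c where c: "\<And>w. length w = n \<Longrightarrow> g w = word_eval n c w"
    using assms(1) unfolding representable_def by blast
  show ?thesis
    by (rule exI[of _ "\<lambda>k. word_eval (n - k) (\<lambda>a. c (k # a))"])
      (simp add: representable_word_eval c word_eval_first_block[OF assms(2)])
qed

text \<open>By \<open>block_weight_inverse\<close>, the degree m part of exp x exp y is minus the
  sum over k from 1 to m of (-1)^k times the degree k part of exp y exp x times the degree m - k
  part of exp x exp y. Substituting this for each first factor and collecting by k leaves cofactors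
  in the same algebra.\<close>

lemma representable_decomp_True:
  fixes g :: "bool list \<Rightarrow> 'a::field"
  assumes "representable n g" "n \<ge> 1" "fct n \<noteq> (0::'a)"
  shows "\<exists>h. (\<forall>k\<in>{1..n}. representable (n - k) (h k)) \<and>
    (\<forall>w. length w = n \<longrightarrow> g w = (\<Sum>k=1..n. block_weight True (take k w) * h k (drop k w)))"
proof -
  obtain q where q: "\<And>k. k \<in> {1..n} \<Longrightarrow> representable (n - k) (q k)"
    "\<And>w. length w = n \<Longrightarrow> g w = (\<Sum>m=1..n. block_weight False (take m w) * q m (drop m w))"
    using representable_decomp_False[OF assms(1,2)] by blast
  define h where "h k v = - ((- 1) ^ k) * (\<Sum>m=k..n. block_weight False (take (m - k) v) * q m (drop (m - k) v))"
    for k v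
  have "representable (n - k) (h k)" if "k \<in> {1..n}" for k
    unfolding h_def
  proof (intro representable_scale representable_sum)
    fix m assume m: "m \<in> {k..n}"
    show "representable (n - k) (\<lambda>v. block_weight False (take (m - k) v) * q m (drop (m - k) v))"
      by (rule representable_prepend) (use m that q(1)[of m] in auto)
  qed
  moreover have "g w = (\<Sum>k=1..n. block_weight True (take k w) * h k (drop k w))" if w: "length w = n" for w
  proof -
    have split: "block_weight False (take m w) =
        (\<Sum>k=1..m. - ((- 1) ^ k) * block_weight True (take k w) *
           (block_weight False (take (m - k) (drop k w)) :: 'a))" if "m \<in> {1..n}" for m
    proof -
      let ?t = "\<lambda>k. (- 1) ^ k * block_weight True (take k (take m w)) *
         (block_weight False (drop k (take m w)) :: 'a)"
      have len: "length (take m w) = m" using that w by simp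
      have "sum ?t {..m} = 0"
      proof -
        have "take m w \<noteq> []" using len that by auto
        moreover have "fct (length (take m w)) \<noteq> (0::'a)"
          using fact_nonzero_le[OF assms(3), of m] len that by simp
        ultimately show ?thesis using block_weight_inverse[of "take m w", where 'a='a] len by simp
      qed
      \<comment> \<open>The summand for k = 0 is the first block itself, and the identity is solved
        for it.\<close>
      moreover have "sum ?t {..m} = ?t 0 + sum ?t {1..m}"
        using sum.atLeast_Suc_atMost[of 0 m ?t] by (simp add: atMost_atLeast0)
      ultimately have "block_weight False (take m w) = - sum ?t {1..m}"
        by (simp add: eq_neg_iff_add_eq_0)
      also have "\<dots> = (\<Sum>k=1..m. - ((- 1) ^ k) * block_weight True (take k w) *
           block_weight False (take (m - k) (drop k w)))"
        unfolding sum_negf[symmetric] by (rule sum.cong[OF refl]) (simp add: min_def drop_take)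
      finally show ?thesis .
    qed
    let ?T = "\<lambda>m k. - ((- 1) ^ k) * block_weight True (take k w) *
           (block_weight False (take (m - k) (drop k w)) :: 'a) * q m (drop m w)"
    have "g w = (\<Sum>m=1..n. \<Sum>k=1..m. ?T m k)"
      unfolding q(2)[OF w] by (rule sum.cong[OF refl]) (simp only: split sum_distrib_right)
    also have "\<dots> = (\<Sum>m\<in>{1..n}. \<Sum>k\<in>{k\<in>{1..n}. k \<le> m}. ?T m k)"
      by (intro sum.cong refl) auto
    also have "\<dots> = (\<Sum>k\<in>{1..n}. \<Sum>m\<in>{m\<in>{1..n}. k \<le> m}. ?T m k)"
      by (rule sum.swap_restrict) auto
    also have "\<dots> = (\<Sum>k=1..n. block_weight True (take k w) * h k (drop k w))"
    proof (rule sum.cong[OF refl])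
      fix k assume k: "k \<in> {1..n}"
      have "(\<Sum>m\<in>{m\<in>{1..n}. k \<le> m}. ?T m k) = (\<Sum>m=k..n. ?T m k)"
        by (rule sum.cong) (use k in auto)
      also have "\<dots> = (\<Sum>m=k..n. block_weight True (take k w) * (- ((- 1) ^ k) *
          (block_weight False (take (m - k) (drop k w)) * q m (drop (m - k) (drop k w)))))"
        by (rule sum.cong[OF refl]) simp
      finally show "(\<Sum>m\<in>{m\<in>{1..n}. k \<le> m}. ?T m k) = block_weight True (take k w) * h k (drop k w)"
        by (simp only: h_def sum_distrib_left)
    qed
    finally show ?thesis .
  qed
  ultimately show ?thesis by blast
qed

lemma representable_decomp:
  fixes g :: "bool list \<Rightarrow> 'a::field"
  assumes "representable n g" "n \<ge> 1" "fct n \<noteq> (0::'a)"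
  obtains h where "\<And>k. k \<in> {1..n} \<Longrightarrow> representable (n - k) (h k)"
    "\<And>w. length w = n \<Longrightarrow> g w = (\<Sum>k=1..n. block_weight x (take k w) * h k (drop k w))"
proof -
  have "\<exists>h. (\<forall>k\<in>{1..n}. representable (n - k) (h k)) \<and>
    (\<forall>w. length w = n \<longrightarrow> g w = (\<Sum>k=1..n. block_weight x (take k w) * h k (drop k w)))"
    using representable_decomp_False[OF assms(1,2)] representable_decomp_True[OF assms]
    by (cases x) simp_all
  then show ?thesis using that by blast
qed

section \<open>Vanishing on all words with a prescribed first letter\<close>

text \<open>Evaluating at k letters \<open>\<not> x\<close> followed by \<open>v\<close>, where
  \<open>v\<close> is empty or starts with \<open>x\<close>, isolates \<open>h k v\<close>: shorter
  first blocks vanish by induction, and a longer one starts with \<open>\<not> x\<close> yet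
  contains \<open>x\<close>, so its weight is 0. This settles \<open>h k\<close> on words starting
  with \<open>x\<close>, and \<open>determined\<close> extends it to all words; for
  \<open>k = n\<close> only the empty word is left.\<close>

lemma first_block_coefficients_vanish:
  fixes h :: "nat \<Rightarrow> bool list \<Rightarrow> 'a::field"
  assumes fact: "fct n \<noteq> (0::'a)"
    and vanish: "\<And>w. length w = n \<Longrightarrow> hd w = (\<not> x) \<Longrightarrow>
      (\<Sum>k=1..n. block_weight x (take k w) * h k (drop k w)) = 0"
    and determined: "\<And>k w. k \<in> {1..<n} \<Longrightarrow>
      (\<And>v. length v = n - k \<Longrightarrow> hd v = x \<Longrightarrow> h k v = 0) \<Longrightarrow> length w = n - k \<Longrightarrow> h k w = 0"
    and k: "k \<in> {1..n}" "length v = n - k"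
  shows "h k v = 0"
  using k
proof (induction k arbitrary: v rule: less_induct)
  case (less k)
  have start: "h k v = 0" if v: "length v = n - k" "v = [] \<or> hd v = x" for v
  proof -
    let ?w = "replicate k (\<not> x) @ v"
    have w: "length ?w = n" "hd ?w = (\<not> x)" using v less.prems by (auto simp: hd_append)
    have other: "block_weight x (take j ?w) * h j (drop j ?w) = 0" if "j \<in> {1..n}" "j \<noteq> k" for j
    proof (cases "j < k")
      case True
      then have "h j (drop j ?w) = 0" using less.IH[of j "drop j ?w"] that w by simp
      then show ?thesis by simp
    next
      case False
      with that have j: "k < j" by simp
      have "v \<noteq> []" using v j that less.prems by auto
      with v have hv: "hd v = x" by simp
      have tk: "take j ?w = replicate k (\<not> x) @ take (j - k) v" using j by simp
      have "hd v \<in> set (take j ?w)" using j \<open>v \<noteq> []\<close>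
        by (cases v) (auto simp: take_Cons')
      then have "take j ?w \<noteq> replicate (length (take j ?w)) (\<not> x)"
        using hv by (metis in_set_replicate)
      moreover have "take j ?w \<noteq> []" "hd (take j ?w) = (\<not> x)"
        using less.prems unfolding tk by (auto simp: hd_append)
      ultimately show ?thesis using block_weight_start_not[of "take j ?w" x, where 'a='a] by simp
    qed
    have "0 = (\<Sum>j=1..n. block_weight x (take j ?w) * h j (drop j ?w))"
      using vanish[OF w] by simp
    also have "\<dots> = (\<Sum>j=1..n. if j = k then block_weight x (take k ?w) * h k (drop k ?w) else 0)"
      by (rule sum.cong[OF refl]) (use other in auto)
    also have "\<dots> = block_weight x (take k ?w) * h k (drop k ?w)" using less.prems by simp
    also have "\<dots> = 1 / fct k * h k v" by (simp add: block_weight_replicate_not)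
    finally show ?thesis using fact_nonzero_le[OF fact, of k] less.prems by simp
  qed
  show ?case
  proof (cases "k = n")
    case True
    then show ?thesis using start less.prems by simp
  next
    case False
    then show ?thesis using determined[of k v] start less.prems by simp
  qed
qed

text \<open>Expand by blocks x^l y^c with x the other letter. The cofactors then have no monomial
  starting with x, and the induction applies to them with the letters exchanged. This alternation is
  why expansions in both orders are available.\<close>

lemma representable_vanish:
  fixes g :: "bool list \<Rightarrow> 'a::field"
  assumes "fct n \<noteq> (0::'a)" "n \<ge> 1" "representable n g"
    and "\<And>w. length w = n \<Longrightarrow> hd w = y \<Longrightarrow> g w = 0"
    and "length w = n"
  shows "g w = 0"
  using assms
proof (induction n arbitrary: g y w rule: less_induct)
  case (less n)
  obtain h where h: "\<And>k. k \<in> {1..n} \<Longrightarrow> representable (n - k) (h k)"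
    "\<And>w. length w = n \<Longrightarrow> g w = (\<Sum>k=1..n. block_weight (\<not> y) (take k w) * h k (drop k w))"
    using representable_decomp[OF less.prems(3,2,1)] by blast
  have "h k v = 0" if "k \<in> {1..n}" "length v = n - k" for k v
  proof (rule first_block_coefficients_vanish[OF less.prems(1) _ _ that, where x = "\<not> y"])
    fix w :: "bool list" assume "length w = n" "hd w = (\<not> \<not> y)"
    then show "(\<Sum>k=1..n. block_weight (\<not> y) (take k w) * h k (drop k w)) = 0"
      using less.prems(4)[of w] h(2)[of w] by simp
  next
    fix j and w :: "bool list" assume j: "j \<in> {1..<n}" "\<And>v. length v = n - j \<Longrightarrow> hd v = (\<not> y) \<Longrightarrow> h j v = 0"
      "length w = n - j"
    show "h j w = 0"
      by (rule less.IH[of "n - j" "h j" "\<not> y"])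
        (use j h(1)[of j] fact_nonzero_le[OF less.prems(1), of "n - j"] in auto)
  qed
  then show ?case using h(2)[OF less.prems(5)] less.prems(5) by simp
qed

text \<open>The products of homogeneous parts indexed by compositions stay linearly independent when
  all words starting with \<open>False\<close> are discarded. The cofactors of the first blocks
  vanish by \<open>representable_vanish\<close>, and induction on the degree recovers the individual
  coefficients.\<close>

theorem word_eval_vanish:
  fixes c :: "nat list \<Rightarrow> 'a::field"
  assumes "fct n \<noteq> (0::'a)" "\<And>w. length w = n \<Longrightarrow> w = [] \<or> hd w \<Longrightarrow> word_eval n c w = 0" "a \<in> comps n"
  shows "c a = 0"
  using assms
proof (induction n arbitrary: c a rule: less_induct)
  case (less n)
  show ?case
  proof (cases "n = 0")
    case True
    \<comment> \<open>In degree 0 the empty word carries the only coefficient; since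
      \<open>hd []\<close> is unspecified, the hypothesis names \<open>w = []\<close>
      separately.\<close>
    then show ?thesis using less.prems(2)[of "[]"] less.prems(3) by (simp add: word_eval_0 comps_0)
  next
    case False
    then obtain k b where a: "a = k # b" "k \<in> {1..n}" "b \<in> comps (n - k)"
      using less.prems(3) comps_decomp[of n] by auto
    have "word_eval (n - k) (\<lambda>a. c (k # a)) v = 0" if "length v = n - k" for v
    proof (rule first_block_coefficients_vanish[OF less.prems(1) _ _ a(2) that, where x = False])
      fix w :: "bool list" assume "length w = n" "hd w = (\<not> False)"
      then show "(\<Sum>k=1..n. block_weight False (take k w) *
          word_eval (n - k) (\<lambda>a. c (k # a)) (drop k w)) = 0"
        using less.prems(2)[of w] word_eval_first_block[of n c w] False by simp
    next
      fix j and w :: "bool list" assume j: "j \<in> {1..<n}" "length w = n - j"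
        "\<And>v. length v = n - j \<Longrightarrow> hd v = False \<Longrightarrow> word_eval (n - j) (\<lambda>a. c (j # a)) v = 0"
      show "word_eval (n - j) (\<lambda>a. c (j # a)) w = 0"
        by (rule representable_vanish[where n = "n - j" and y = False])
          (use j fact_nonzero_le[OF less.prems(1), of "n - j"] representable_word_eval in auto)
    qed
    then show ?thesis
      using less.IH[of "n - k" "\<lambda>a. c (k # a)" b] a fact_nonzero_le[OF less.prems(1), of "n - k"] by simp
  qed
qed


section \<open>Rank jumps along an ordering\<close>

definition rk :: "'e base_system \<Rightarrow> 'e set \<Rightarrow> nat" where
  "rk M S = Max (card ` {J. J \<subseteq> S \<and> indep M J})"

definition jumps :: "'e base_system \<Rightarrow> 'e list \<Rightarrow> bool list" where
  "jumps M xs = map (\<lambda>i. rk M (set (take i xs)) < rk M (set (take (Suc i) xs))) [0..<length xs]"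

definition greedy :: "'e base_system \<Rightarrow> 'e list \<Rightarrow> 'e set" where
  "greedy M xs = {xs ! i | i. i < length xs \<and> jumps M xs ! i}"

lemma length_jumps [simp]: "length (jumps M xs) = length xs"
  by (simp add: jumps_def)

lemma nth_jumps:
  "i < length xs \<Longrightarrow> jumps M xs ! i \<longleftrightarrow> rk M (set (take i xs)) < rk M (set (take (Suc i) xs))"
  by (simp add: jumps_def)

lemma jumps_take: "jumps M (take i xs) = take i (jumps M xs)"
proof (rule nth_equalityI)
  fix j assume "j < length (jumps M (take i xs))"
  then have "j < length xs" "j < i" by simp_all
  then show "jumps M (take i xs) ! j = take i (jumps M xs) ! j"
    by (simp add: nth_jumps min.absorb1)
qed simp

lemma jumps_snoc: "jumps M (xs @ [x]) = jumps M xs @ [rk M (set xs) < rk M (insert x (set xs))]"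
  by (rule nth_equalityI) (auto simp: nth_jumps nth_append less_Suc_eq)

lemma greedy_snoc:
  "greedy M (xs @ [x]) = greedy M xs \<union> (if rk M (set xs) < rk M (insert x (set xs)) then {x} else {})"
proof -
  have image: "greedy M ys = (!) ys ` {i. i < length ys \<and> jumps M ys ! i}" for ys
    by (auto simp: greedy_def)
  have "{i. i < length (xs @ [x]) \<and> jumps M (xs @ [x]) ! i} = {i. i < length xs \<and> jumps M xs ! i}
      \<union> (if rk M (set xs) < rk M (insert x (set xs)) then {length xs} else {})"
    by (auto simp: less_Suc_eq jumps_snoc nth_append)
  moreover have "(!) (xs @ [x]) ` {i. i < length xs \<and> jumps M xs ! i} = greedy M xs"
    unfolding image by (rule image_cong) (auto simp: nth_append)
  ultimately show ?thesis unfolding image[of "xs @ [x]"] by (simp add: image_Un)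
qed

lemma greedy_subset: "greedy M xs \<subseteq> set xs"
  by (auto simp: greedy_def)

lemma jumps_eq_map_greedy:
  assumes "distinct xs"
  shows "jumps M xs = map (\<lambda>x. x \<in> greedy M xs) xs"
  by (rule nth_equalityI) (use assms in \<open>auto simp: greedy_def nth_eq_iff_index_eq\<close>)

lemma greedy_Int_take:
  assumes "distinct xs"
  shows "greedy M xs \<inter> set (take i xs) = greedy M (take i xs)"
proof (intro equalityI subsetI)
  fix x assume "x \<in> greedy M xs \<inter> set (take i xs)"
  then obtain j k where "x = xs ! j" "j < length xs" "jumps M xs ! j" "x = xs ! k" "k < i" "k < length xs"
    by (auto simp: greedy_def in_set_conv_nth)
  moreover from this assms have "j = k" by (simp add: nth_eq_iff_index_eq)
  ultimately show "x \<in> greedy M (take i xs)"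
    by (auto simp: greedy_def jumps_take intro!: exI[of _ k])
next
  fix x assume "x \<in> greedy M (take i xs)"
  then show "x \<in> greedy M xs \<inter> set (take i xs)"
    using greedy_subset[of M "take i xs"] by (auto simp: greedy_def jumps_take)
qed

section \<open>Rank function and the greedy base\<close>

context
  fixes M :: "'e base_system"
  assumes M: "matroid M"
begin

lemma indep_subset: "indep M J \<Longrightarrow> I \<subseteq> J \<Longrightarrow> indep M I"
  by (auto simp: indep_def)

lemma indep_empty: "indep M {}"
  using M by (auto simp: indep_def matroid_def)

lemma base_indep: "B \<in> bases M \<Longrightarrow> indep M B"
  by (auto simp: indep_def)

lemma indep_subset_ground: "indep M J \<Longrightarrow> J \<subseteq> ground M"
  using M by (auto simp: indep_def matroid_def)

lemma indep_finite: "indep M J \<Longrightarrow> finite J"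
  using matroid_base_finite[OF M] finite_subset by (auto simp: indep_def)

lemma finite_indep_sets: "finite {J. J \<subseteq> S \<and> indep M J}"
proof -
  have "finite (ground M)" using M by (simp add: matroid_def)
  then have "finite (Pow (ground M))" by simp
  then show ?thesis by (rule rev_finite_subset) (use indep_subset_ground in blast)
qed

lemma indep_card_le_rk: "indep M J \<Longrightarrow> J \<subseteq> S \<Longrightarrow> card J \<le> rk M S"
  unfolding rk_def using finite_indep_sets by (intro Max_ge) auto

lemma rk_witness:
  obtains J where "J \<subseteq> S" "indep M J" "card J = rk M S"
proof -
  have "{J. J \<subseteq> S \<and> indep M J} \<noteq> {}" using indep_empty by auto
  then have "rk M S \<in> card ` {J. J \<subseteq> S \<and> indep M J}"
    unfolding rk_def using finite_indep_sets by (intro Max_in) auto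
  then show ?thesis using that by auto
qed

lemma rk_mono: "S \<subseteq> T \<Longrightarrow> rk M S \<le> rk M T"
  by (metis rk_witness indep_card_le_rk subset_trans)

lemma rk_insert_le: "rk M (insert x S) \<le> Suc (rk M S)"
proof -
  obtain J where J: "J \<subseteq> insert x S" "indep M J" "card J = rk M (insert x S)" by (rule rk_witness)
  have "card (J - {x}) \<le> rk M S"
    by (rule indep_card_le_rk) (use J indep_subset in auto)
  moreover have "card J \<le> Suc (card (J - {x}))"
    by (auto simp: card_Diff_singleton_if)
  ultimately show ?thesis using J(3) by linarith
qed

lemma rk_empty: "rk M {} = 0"
  by (metis rk_witness card.empty subset_empty)

lemma rk_ground: "rk M (ground M) = rank M"
proof -
  have "{J. J \<subseteq> ground M \<and> indep M J} = Collect (indep M)" using indep_subset_ground by auto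
  then show ?thesis by (simp add: rk_def rank_def)
qed

text \<open>Let \<open>B\<close> be a base containing \<open>I\<close>, and extend \<open>J\<close>
  to a base \<open>C\<close> inside \<open>J \<union> B\<close>. Then \<open>C - J\<close> has more
  elements than \<open>B - I\<close>, so it meets \<open>I\<close>.\<close>

lemma indep_augment:
  assumes "indep M J" "indep M I" "card J < card I"
  shows "\<exists>y\<in>I - J. indep M (insert y J)"
proof -
  obtain B where B: "B \<in> bases M" "I \<subseteq> B" using assms by (auto simp: indep_def)
  obtain C where C: "C \<in> bases M" "J \<subseteq> C" "C \<subseteq> J \<union> B"
    using matroid_extend_into[OF M assms(1) B(1)] by auto
  have fin: "finite B" "finite C" "finite I" "finite J"
    using B C assms indep_finite base_indep by auto
  have "card (C - J) = rank M - card J" "card (B - I) = rank M - card I" "card I \<le> rank M"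
    using B C fin matroid_base_card[OF M] by (auto simp: card_Diff_subset) (metis card_mono)
  then have "card (B - I) < card (C - J)" using assms(3) by linarith
  then have "\<not> C - J \<subseteq> B - I" using fin by (metis card_mono finite_Diff not_le)
  then obtain y where "y \<in> C" "y \<notin> J" "y \<in> I" using C by auto
  then show ?thesis using C by (auto simp: indep_def)
qed

lemma greedy_indep:
  assumes "distinct xs"
  shows "indep M (greedy M xs) \<and> card (greedy M xs) = rk M (set xs)"
  using assms
proof (induction xs rule: rev_induct)
  case Nil
  then show ?case by (simp add: greedy_def indep_empty rk_empty)
next
  case (snoc x xs)
  let ?J = "greedy M xs"
  have IH: "indep M ?J" "card ?J = rk M (set xs)" and x: "x \<notin> set xs" "x \<notin> ?J"
    using snoc greedy_subset[of M xs] by auto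
  show ?case
  proof (cases "rk M (set xs) < rk M (insert x (set xs))")
    case True
    obtain I where I: "I \<subseteq> insert x (set xs)" "indep M I" "card I = rk M (insert x (set xs))"
      by (rule rk_witness)
    obtain y where y: "y \<in> I - ?J" "indep M (insert y ?J)"
      using indep_augment[OF IH(1) I(2)] True IH I by auto
    \<comment> \<open>Any other augmenting element would give an independent subset of
      \<open>set xs\<close> larger than its rank.\<close>
    have "y = x"
    proof (rule ccontr)
      assume "y \<noteq> x"
      then have "insert y ?J \<subseteq> set xs" using y I greedy_subset[of M xs] by auto
      then have "card (insert y ?J) \<le> rk M (set xs)" using y indep_card_le_rk by blast
      then show False using y IH indep_finite[OF IH(1)] by simp
    qed
    moreover have "rk M (insert x (set xs)) = Suc (rk M (set xs))"
      using True rk_insert_le[of x "set xs"] by simp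
    ultimately show ?thesis using y True IH x indep_finite[OF IH(1)] by (simp add: greedy_snoc)
  next
    case False
    then have "rk M (insert x (set xs)) = rk M (set xs)"
      using rk_mono[OF subset_insertI, of "set xs" x] by simp
    then show ?thesis using False IH by (simp add: greedy_snoc)
  qed
qed

lemma indep_card_rank_base:
  assumes "indep M J" "card J = rank M"
  shows "J \<in> bases M"
proof -
  obtain B where B: "B \<in> bases M" "J \<subseteq> B" using assms by (auto simp: indep_def)
  then have "J = B"
    using assms matroid_base_card[OF M B(1)] matroid_base_finite[OF M B(1)] by (metis card_subset_eq)
  then show ?thesis using B by simp
qed

lemma greedy_base:
  assumes "distinct xs" "set xs = ground M"
  shows "greedy M xs \<in> bases M"
  using greedy_indep[OF assms(1)] assms(2) rk_ground indep_card_rank_base by simp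

text \<open>One more element raises the rank by at most one, so the ranks of initial parts can be
  recovered from the jump word.\<close>

lemma count_jumps: "count_list (jumps M xs) True = rk M (set xs)"
proof (induction xs rule: rev_induct)
  case Nil
  then show ?case by (simp add: jumps_def rk_empty)
next
  case (snoc x xs)
  then show ?case
    using rk_insert_le[of x "set xs"] rk_mono[OF subset_insertI, of "set xs" x]
    by (auto simp: jumps_snoc)
qed

lemma count_take_jumps: "count_list (take i (jumps M xs)) True = rk M (set (take i xs))"
  by (simp add: count_jumps flip: jumps_take)

end

section \<open>Weights of bases through sublevel sets\<close>

text \<open>An element \<open>e\<close> is counted once for each t with \<open>f e \<le> t\<close>
  and \<open>t < T\<close>, hence \<open>T - f e\<close> times. For sets of equal size, a small
  weight therefore means large sublevel counts.\<close>

lemma sum_weight_layers: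
  fixes f :: "'e \<Rightarrow> nat"
  assumes "finite B" "\<And>e. e \<in> B \<Longrightarrow> f e \<le> T"
  shows "sum f B + (\<Sum>t<T. card {e \<in> B. f e \<le> t}) = T * card B"
  using assms
proof (induction B rule: finite_induct)
  case (insert e B)
  have "card {d \<in> insert e B. f d \<le> t} = card {d \<in> B. f d \<le> t} + (if f e \<le> t then 1 else 0)" for t
  proof (cases "f e \<le> t")
    case True
    then have "{d \<in> insert e B. f d \<le> t} = insert e {d \<in> B. f d \<le> t}" by auto
    then show ?thesis using True insert by simp
  next
    case False
    then have "{d \<in> insert e B. f d \<le> t} = {d \<in> B. f d \<le> t}" by auto
    then show ?thesis using False by simp
  qed
  then have "(\<Sum>t<T. card {d \<in> insert e B. f d \<le> t}) =
      (\<Sum>t<T. card {d \<in> B. f d \<le> t}) + (\<Sum>t<T. if f e \<le> t then 1 else 0)"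
    by (simp add: sum.distrib)
  moreover have "(\<Sum>t<T. if f e \<le> t then 1 else 0) = T - f e"
  proof -
    have "{t. t < T \<and> f e \<le> t} = {f e..<T}" by auto
    moreover have "(\<Sum>t<T. if f e \<le> t then 1 else 0) = card {t. t < T \<and> f e \<le> t}"
      by (simp add: sum.If_cases Int_def)
    ultimately show ?thesis by simp
  qed
  moreover have "f e \<le> T" using insert by simp
  moreover have "sum f B + (\<Sum>t<T. card {e \<in> B. f e \<le> t}) = T * card B" using insert by simp
  ultimately show ?case using insert(1,2) by (simp add: add.assoc)
qed simp

lemma sorted_sublevel_takeWhile:
  fixes f :: "'e \<Rightarrow> nat"
  assumes "sorted (map f xs)"
  shows "{e \<in> set xs. f e \<le> t} = set (takeWhile (\<lambda>e. f e \<le> t) xs)"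
  using assms
proof (induction xs)
  case (Cons x xs)
  then show ?case by (cases "f x \<le> t") auto
qed simp

context
  fixes M :: "'e base_system" and f :: "'e \<Rightarrow> nat" and xs :: "'e list"
  assumes M: "matroid M" and xs: "distinct xs" "set xs = ground M" and sorted: "sorted (map f xs)"
begin

lemma base_sublevel_card_le:
  assumes "B \<in> bases M"
  shows "card {e \<in> B. f e \<le> t} \<le> rk M {e \<in> ground M. f e \<le> t}"
proof (rule indep_card_le_rk[OF M])
  show "indep M {e \<in> B. f e \<le> t}"
    by (rule indep_subset[OF M base_indep[OF M assms]]) auto
  show "{e \<in> B. f e \<le> t} \<subseteq> {e \<in> ground M. f e \<le> t}"
    using M assms by (auto simp: matroid_def)
qed

lemma sublevel_eq_take:
  obtains m where "m \<le> length xs" "{e \<in> ground M. f e \<le> t} = set (take m xs)"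
proof -
  obtain m where "takeWhile (\<lambda>e. f e \<le> t) xs = take m xs" "m \<le> length xs"
    by (metis takeWhile_eq_take length_takeWhile_le)
  then show ?thesis using that sorted_sublevel_takeWhile[OF sorted, of t] xs by simp
qed

text \<open>A sublevel set is an initial part of the sorted ordering, and there the greedy choice
  attains the rank. The bound valid for any base is thus reached at all levels at once.\<close>

lemma greedy_sublevel_card:
  "card {e \<in> greedy M xs. f e \<le> t} = rk M {e \<in> ground M. f e \<le> t}"
proof -
  obtain m where m: "{e \<in> ground M. f e \<le> t} = set (take m xs)" by (rule sublevel_eq_take)
  have "{e \<in> greedy M xs. f e \<le> t} = greedy M xs \<inter> {e \<in> ground M. f e \<le> t}"
    using greedy_subset[of M xs] xs by auto
  also have "\<dots> = greedy M (take m xs)" unfolding m by (rule greedy_Int_take[OF xs(1)])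
  finally show ?thesis using greedy_indep[OF M, of "take m xs"] xs(1) m by simp
qed

text \<open>The total weight of the ground set serves as a cutoff above all labels that is the same
  for every base.\<close>

lemma base_weight_layers:
  assumes "B \<in> bases M"
  shows "sum f B + (\<Sum>t<sum f (ground M). card {e \<in> B. f e \<le> t}) = sum f (ground M) * rank M"
proof -
  have "finite (ground M)" "B \<subseteq> ground M" using M assms by (auto simp: matroid_def)
  then have "f e \<le> sum f (ground M)" if "e \<in> B" for e
    using that by (intro member_le_sum) auto
  then show ?thesis
    using sum_weight_layers[OF matroid_base_finite[OF M assms], of f "sum f (ground M)"]
      matroid_base_card[OF M assms] by simp
qed

lemma greedy_minimal:
  assumes "B \<in> bases M"
  shows "sum f (greedy M xs) \<le> sum f B"
proof -
  have "(\<Sum>t<sum f (ground M). card {e \<in> B. f e \<le> t})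
      \<le> (\<Sum>t<sum f (ground M). card {e \<in> greedy M xs. f e \<le> t})"
    by (rule sum_mono) (simp only: base_sublevel_card_le[OF assms] greedy_sublevel_card)
  then show ?thesis
    using base_weight_layers[OF assms] base_weight_layers[OF greedy_base[OF M xs]] by linarith
qed

text \<open>A base no heavier than the greedy one has at least the same total of sublevel counts,
  while each single count is at most the greedy one; so they agree termwise.\<close>

lemma minimal_base_sublevel_card:
  assumes "B \<in> bases M" "sum f B \<le> sum f (greedy M xs)" "t < sum f (ground M)"
  shows "card {e \<in> B. f e \<le> t} = rk M {e \<in> ground M. f e \<le> t}"
proof -
  have "(\<Sum>t<sum f (ground M). card {e \<in> greedy M xs. f e \<le> t})
      \<le> (\<Sum>t<sum f (ground M). card {e \<in> B. f e \<le> t})"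
    using base_weight_layers[OF assms(1)] base_weight_layers[OF greedy_base[OF M xs]] assms(2)
    by linarith
  moreover have "card {e \<in> B. f e \<le> t} \<le> card {e \<in> greedy M xs. f e \<le> t}" for t
    by (simp only: base_sublevel_card_le[OF assms(1)] greedy_sublevel_card)
  ultimately have "card {e \<in> B. f e \<le> t} = card {e \<in> greedy M xs. f e \<le> t}"
    using assms(3)
    by (intro sum_mono_inv[of "\<lambda>t. card {e \<in> B. f e \<le> t}" "{..<sum f (ground M)}"
          "\<lambda>t. card {e \<in> greedy M xs. f e \<le> t}"])
      (auto intro!: antisym sum_mono)
  then show ?thesis by (simp only: greedy_sublevel_card)
qed

lemma generic_greedy:
  assumes "generic M f" "B \<in> bases M" "\<forall>B'\<in>bases M. sum f B \<le> sum f B'"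
  shows "greedy M xs = B"
  using assms greedy_base[OF M xs] greedy_minimal unfolding generic_def by blast

text \<open>Suppose a minimal base contains a non-jump x. It already attains the rank of the
  elements with labels below \<open>f x\<close>, and no jump of the same label precedes x, so the
  rank does not grow up to and including x. Adding x would exceed it. Hence every minimal base lies
  in the greedy one and equals it by cardinality.\<close>

lemma generic_if_nonjumps_first:
  assumes pos: "\<And>e. e \<in> ground M \<Longrightarrow> f e \<ge> 1"
    and nonjumps_first: "\<And>i j. i < j \<Longrightarrow> j < length xs \<Longrightarrow> f (xs ! i) = f (xs ! j) \<Longrightarrow>
      jumps M xs ! i \<Longrightarrow> jumps M xs ! j"
  shows "generic M f"
  unfolding generic_def
proof (rule ex1I[of _ "greedy M xs"])
  show "greedy M xs \<in> bases M \<and> (\<forall>B'\<in>bases M. sum f (greedy M xs) \<le> sum f B')"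
    using greedy_base[OF M xs] greedy_minimal by blast
  fix B assume B: "B \<in> bases M \<and> (\<forall>B'\<in>bases M. sum f B \<le> sum f B')"
  then have min: "sum f B \<le> sum f (greedy M xs)" using greedy_base[OF M xs] by blast
  have "xs ! i \<notin> B" if i: "i < length xs" "\<not> jumps M xs ! i" for i
  proof
    assume xB: "xs ! i \<in> B"
    let ?x = "xs ! i"
    have gx: "?x \<in> ground M" using nth_mem[OF i(1)] xs(2) by simp
    \<comment> \<open>The largest threshold whose sublevel set excludes \<open>?x\<close>; labels
      are positive, so the subtraction does not truncate.\<close>
    define t where "t = f ?x - 1"
    have t: "f ?x = Suc t" using pos[OF gx] by (simp add: t_def)
    have "f ?x \<le> sum f (ground M)"
      using gx M by (intro member_le_sum) (auto simp: matroid_def)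
    then have card_t: "card {e \<in> B. f e \<le> t} = rk M {e \<in> ground M. f e \<le> t}"
      using minimal_base_sublevel_card[of B t] B min t by simp
    obtain m where m: "m \<le> length xs" "{e \<in> ground M. f e \<le> t} = set (take m xs)"
      by (rule sublevel_eq_take)
    have below: "f (xs ! j) \<le> t \<longleftrightarrow> j < m" if "j < length xs" for j
    proof -
      have "f (xs ! j) \<le> t \<longleftrightarrow> xs ! j \<in> set (take m xs)" using m(2) nth_mem[OF that] xs(2) by blast
      also have "\<dots> \<longleftrightarrow> j < m"
        using that xs(1) m(1) by (auto simp: in_set_conv_nth nth_eq_iff_index_eq)
      finally show ?thesis .
    qed
    have mi: "m \<le> i" using below[of i] i t by simp
    have no_jump: "\<not> jumps M xs ! j" if j: "m \<le> j" "j \<le> i" for j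
    proof
      assume jump: "jumps M xs ! j"
      have "f (xs ! j) \<le> f ?x"
        using sorted_nth_mono[OF sorted, of j i] j i by simp
      moreover have "\<not> f (xs ! j) \<le> t" using below[of j] j i by simp
      ultimately have "f (xs ! j) = f ?x" using t by simp
      then have "jumps M xs ! i" using nonjumps_first[of j i] jump j i by (cases "j = i") auto
      then show False using i by simp
    qed
    have "rk M (set (take (Suc j) xs)) \<le> rk M (set (take m xs))" if "m \<le> j" "j \<le> i" for j
      using that
    proof (induction j rule: dec_induct)
      case base
      then show ?case using no_jump[of m] nth_jumps[of m xs M] i by simp
    next
      case (step j)
      then show ?case using no_jump[of "Suc j"] nth_jumps[of "Suc j" xs M] i by simp
    qed
    from this[of i] have "rk M (set (take (Suc i) xs)) \<le> card {e \<in> B. f e \<le> t}"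
      using mi card_t m by simp
    moreover have "card (insert ?x {e \<in> B. f e \<le> t}) \<le> rk M (set (take (Suc i) xs))"
    proof (rule indep_card_le_rk[OF M])
      show "indep M (insert ?x {e \<in> B. f e \<le> t})"
        by (rule indep_subset[OF M base_indep[OF M]]) (use B xB in auto)
      have "B \<subseteq> ground M" using B M by (auto simp: matroid_def)
      then have "{e \<in> B. f e \<le> t} \<subseteq> set (take m xs)" using m(2) by blast
      moreover have "set (take m xs) \<subseteq> set (take (Suc i) xs)"
        using mi by (intro set_take_subset_set_take) simp
      ultimately show "insert ?x {e \<in> B. f e \<le> t} \<subseteq> set (take (Suc i) xs)"
        using i by (auto simp: take_Suc_conv_app_nth)
    qed
    moreover have "card (insert ?x {e \<in> B. f e \<le> t}) = Suc (card {e \<in> B. f e \<le> t})"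
      using matroid_base_finite[OF M] B t by (intro card_insert_disjoint) auto
    ultimately show False by simp
  qed
  moreover have "B \<subseteq> set xs" using B M xs by (auto simp: matroid_def)
  ultimately have "B \<subseteq> greedy M xs"
    unfolding greedy_def by (smt (verit) in_set_conv_nth mem_Collect_eq subset_iff)
  then show "B = greedy M xs"
    using greedy_base[OF M xs] B matroid_base_card[OF M] matroid_base_finite[OF M]
    by (metis card_subset_eq)
qed

end


section \<open>Coefficients of the quasisymmetric function of a matroid\<close>

text \<open>For increasing \<open>vs\<close>, this is the list of labels read along any ordering
  that sorts a labelling with monomial \<open>xmon vs a\<close>.\<close>

definition level_word :: "nat list \<Rightarrow> nat list \<Rightarrow> nat list" where
  "level_word vs a = concat (map2 replicate a vs)"

lemma level_word_Nil [simp]: "level_word vs [] = []"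
  by (simp add: level_word_def)

lemma level_word_Cons [simp]: "level_word (v # vs) (k # a) = replicate k v @ level_word vs a"
  by (simp add: level_word_def)

lemma length_level_word: "length vs = length a \<Longrightarrow> length (level_word vs a) = sum_list a"
  by (induction vs a rule: list_induct2) auto

lemma set_level_word: "length vs = length a \<Longrightarrow> set (level_word vs a) \<subseteq> set vs"
  by (induction vs a rule: list_induct2) auto

lemma sorted_level_word:
  assumes "length vs = length a" "sorted_wrt (<) vs"
  shows "sorted (level_word vs a)"
  using assms
proof (induction vs a rule: list_induct2)
  case (Cons v vs k a)
  then show ?case using set_level_word[OF Cons.hyps]
    by (auto simp: sorted_append less_imp_le subset_iff)
qed simp

text \<open>Equal entries of the level word lie in the same block because \<open>vs\<close> is
  distinct, and a nonzero weight gives each block the form 0^l 1^c. This supplies the hypothesis of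
  \<open>generic_if_nonjumps_first\<close>.\<close>

lemma comp_weight_nonzero_mono:
  assumes "comp_weight a w \<noteq> (0::'a::field)" "length w = sum_list a" "length vs = length a" "distinct vs"
    and "i < j" "j < length w" "level_word vs a ! i = level_word vs a ! j" "w ! i"
  shows "w ! j"
  using assms(3,1,2,4-)
proof (induction vs a arbitrary: w i j rule: list_induct2)
  case (Cons v vs k a)
  note len = length_level_word[OF Cons.hyps]
  have nz: "block_weight False (take k w) \<noteq> (0::'a)" "comp_weight a (drop k w) \<noteq> (0::'a)"
    using Cons.prems by auto
  consider "j < k" | "i < k" "k \<le> j" | "k \<le> i" using Cons.prems by linarith
  then show ?case
  proof cases
    case 1
    obtain l c where lc: "take k w = replicate l False @ replicate c True"
      using block_weight_nonzeroE[OF nz(1)] by auto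
    have kl: "k = l + c" using arg_cong[OF lc, of length] Cons.prems by simp
    have w: "w ! t = (replicate l False @ replicate c True) ! t" if "t < k" for t
      using that lc by (metis nth_take)
    have "l \<le> i" using w[of i] Cons.prems(7) 1 Cons.prems(4) by (auto simp: nth_append split: if_splits)
    then show ?thesis using w[OF 1] 1 kl Cons.prems(4) by (simp add: nth_append)
  next
    case 2
    have "level_word vs a ! (j - k) \<in> set vs"
      using set_level_word[OF Cons.hyps] len Cons.prems(2,5) 2
      by (metis (no_types, lifting) add_diff_inverse_nat nat_add_left_cancel_less not_less nth_mem
          subsetD sum_list.Cons)
    then show ?thesis using Cons.prems 2 by (simp add: nth_append)
  next
    case 3
    have "drop k w ! (j - k)"
    proof (rule Cons.IH[where i = "i - k"])
      show "level_word vs a ! (i - k) = level_word vs a ! (j - k)"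
        using Cons.prems 3 by (simp add: nth_append)
    qed (use Cons.prems nz 3 in auto)
    then show ?thesis using Cons.prems 3 by simp
  qed
qed simp

section \<open>Weighted counts of orderings\<close>

text \<open>Only the orderings listing \<open>D - B\<close> before \<open>D \<inter> B\<close>
  contribute. There are l! c! of them, each of weight 1 / (l! c!).\<close>

lemma sum_permutations_block_weight:
  assumes "finite D" "fct (card D) \<noteq> (0::'a::field)"
  shows "(\<Sum>q\<in>permutations_of_set D. block_weight False (map (\<lambda>x. x \<in> B) q)) = (1::'a)"
proof -
  define l where "l = card (D - B)"
  define c where "c = card (D \<inter> B)"
  let ?S = "permutations_of_set (D - B) \<times> permutations_of_set (D \<inter> B)"
  let ?u = "replicate l False @ replicate c True"
  have img: "{q \<in> permutations_of_set D. map (\<lambda>x. x \<in> B) q = ?u} = (\<lambda>(s, t). s @ t) ` ?S"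
  proof (intro equalityI subsetI)
    fix q assume q: "q \<in> {q \<in> permutations_of_set D. map (\<lambda>x. x \<in> B) q = ?u}"
    then have qu: "map (\<lambda>x. x \<in> B) q = ?u" and qD: "set q = D" "distinct q"
      by (simp_all add: permutations_of_set_def)
    have t: "map (\<lambda>x. x \<in> B) (take l q) = replicate l False" "map (\<lambda>x. x \<in> B) (drop l q) = replicate c True"
      unfolding take_map[symmetric] drop_map[symmetric] qu by simp_all
    have notB: "x \<notin> B" if "x \<in> set (take l q)" for x
      using imageI[OF that, of "\<lambda>x. x \<in> B"] unfolding set_map[symmetric] t(1) by simp
    have inB: "x \<in> B" if "x \<in> set (drop l q)" for x
      using imageI[OF that, of "\<lambda>x. x \<in> B"] unfolding set_map[symmetric] t(2) by simp
    have "set (take l q) \<union> set (drop l q) = D" using qD(1) by (metis append_take_drop_id set_append)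
    then have "set (take l q) = D - B" "set (drop l q) = D \<inter> B" using notB inB by blast+
    then have "(take l q, drop l q) \<in> ?S" using qD by (simp add: permutations_of_set_def)
    then show "q \<in> (\<lambda>(s, t). s @ t) ` ?S" by (rule rev_image_eqI) simp
  next
    fix q assume "q \<in> (\<lambda>(s, t). s @ t) ` ?S"
    then obtain s t where st: "q = s @ t" "set s = D - B" "distinct s" "set t = D \<inter> B" "distinct t"
      by (auto simp: permutations_of_set_def)
    have "length s = l" "length t = c" using st distinct_card by (fastforce simp: l_def c_def)+
    moreover have "map (\<lambda>x. x \<in> B) s = map (\<lambda>_. False) s" "map (\<lambda>x. x \<in> B) t = map (\<lambda>_. True) t"
      using st by auto
    ultimately have "map (\<lambda>x. x \<in> B) q = ?u" using st by (simp add: map_replicate_const)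
    then show "q \<in> {q \<in> permutations_of_set D. map (\<lambda>x. x \<in> B) q = ?u}"
      using st by (auto simp: permutations_of_set_def)
  qed
  have inj: "inj_on (\<lambda>(s, t). s @ t) ?S"
  proof (rule inj_onI, clarsimp)
    fix s t s' t'
    assume "s \<in> permutations_of_set (D - B)" "s' \<in> permutations_of_set (D - B)" "s @ t = s' @ t'"
    then show "s = s' \<and> t = t'" by (simp add: append_eq_append_conv length_finite_permutations_of_set)
  qed
  have zero: "block_weight False (map (\<lambda>x. x \<in> B) q) = (0::'a)"
    if q: "q \<in> permutations_of_set D" "map (\<lambda>x. x \<in> B) q \<noteq> ?u" for q
  proof (rule ccontr)
    assume "\<not> ?thesis"
    then obtain l' c' where eq: "map (\<lambda>x. x \<in> B) q = replicate l' False @ replicate c' True"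
      using block_weight_nonzeroE by (metis (full_types))
    have qD: "set q = D" "distinct q" using q by (auto simp: permutations_of_set_def)
    have "length (filter (\<lambda>x. x \<in> B) q) = c"
      using qD by (simp add: c_def distinct_card[symmetric] Int_def)
    moreover have "length (filter (\<lambda>x. x \<in> B) q) = length (filter (\<lambda>b. b) (map (\<lambda>x. x \<in> B) q))"
      by (simp add: filter_map comp_def)
    ultimately have "c' = c" using eq by simp
    moreover have "length (filter (\<lambda>x. x \<notin> B) q) = l"
      using qD by (simp add: l_def distinct_card[symmetric] set_diff_eq)
    moreover have "length (filter (\<lambda>x. x \<notin> B) q) = length (filter (\<lambda>b. \<not> b) (map (\<lambda>x. x \<in> B) q))"
      by (simp add: filter_map comp_def)
    ultimately show False using eq q by simp
  qed
  have nz: "fct l \<noteq> (0::'a)" "fct c \<noteq> (0::'a)"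
    using fact_nonzero_le[OF assms(2)] assms(1) by (simp_all add: l_def c_def card_mono)
  have "(\<Sum>q\<in>permutations_of_set D. block_weight False (map (\<lambda>x. x \<in> B) q)) =
      (\<Sum>q\<in>{q \<in> permutations_of_set D. map (\<lambda>x. x \<in> B) q = ?u}. (block_weight False ?u :: 'a))"
    by (rule sum.mono_neutral_cong_right) (use assms(1) zero in auto)
  also have "\<dots> = of_nat (card ?S) * (1 / (fct l * fct c))"
    using block_weight_replicate[of False l c, where 'a='a]
    by (simp only: img card_image[OF inj] sum_constant) simp
  also have "card ?S = fact l * fact c"
    using assms(1) by (simp add: l_def c_def card_cartesian_product)
  finally show ?thesis using nz by simp
qed

text \<open>A sorted ordering lists the level sets of \<open>f\<close> one after another, so the sum
  is a product over the levels, each factor being 1 by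
  \<open>sum_permutations_block_weight\<close>.\<close>

lemma sum_sorted_permutations_comp_weight:
  fixes f :: "'e \<Rightarrow> nat"
  assumes "length vs = length a" "distinct vs" "finite E"
    and "image_mset f (mset_set E) = mset (level_word vs a)" "fct (card E) \<noteq> (0::'a::field)"
  shows "(\<Sum>p\<in>{p \<in> permutations_of_set E. map f p = level_word vs a}.
     comp_weight a (map (\<lambda>x. x \<in> B) p)) = (1::'a)"
  using assms
proof (induction vs a arbitrary: E rule: list_induct2)
  case Nil
  then have "E = {}" by (simp add: mset_set_empty_iff)
  then have "{p \<in> permutations_of_set E. map f p = level_word [] []} = {[]}" by auto
  then show ?case by simp
next
  case (Cons v vs k a)
  define D where "D = {e \<in> E. f e = v}"
  have vn: "v \<notin> set (level_word vs a)"
    using set_level_word[OF Cons.hyps] Cons.prems(1) by auto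
  have fin: "finite D" "finite (E - D)" using Cons.prems by (auto simp: D_def)
  have split: "mset_set E = mset_set D + mset_set (E - D)"
    using mset_set_Union[of D "E - D"] fin by (simp add: D_def Un_absorb1)
  have "card D = size (filter_mset (\<lambda>y. y = v) (image_mset f (mset_set E)))"
    using Cons.prems(2) by (simp add: filter_mset_image_mset D_def)
  also have "\<dots> = k"
    using vn by (simp add: Cons.prems(3) filter_eq_replicate_mset count_eq_zero_iff)
  finally have cardD: "card D = k" .
  have "image_mset f (mset_set D) = replicate_mset k v"
  proof -
    have "image_mset f (mset_set D) = image_mset (\<lambda>_. v) (mset_set D)"
      by (rule image_mset_cong) (use fin in \<open>auto simp: D_def\<close>)
    then show ?thesis using cardD by (simp add: image_mset_const_eq)
  qed
  then have rest: "image_mset f (mset_set (E - D)) = mset (level_word vs a)"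
    using Cons.prems(3) split by simp
  let ?R = "{r \<in> permutations_of_set (E - D). map f r = level_word vs a}"
  have img: "{p \<in> permutations_of_set E. map f p = level_word (v # vs) (k # a)} =
      (\<lambda>(q, r). q @ r) ` (permutations_of_set D \<times> ?R)"
  proof (intro equalityI subsetI)
    fix p assume "p \<in> {p \<in> permutations_of_set E. map f p = level_word (v # vs) (k # a)}"
    then have p: "set p = E" "distinct p" "map f p = replicate k v @ level_word vs a"
      by (auto simp: permutations_of_set_def)
    have t: "map f (take k p) = replicate k v" "map f (drop k p) = level_word vs a"
      using arg_cong[OF p(3), of "take k"] arg_cong[OF p(3), of "drop k"] by (simp_all add: take_map drop_map)
    have "f x = v" if "x \<in> set (take k p)" for x
      using that arg_cong[OF t(1), of set] by (auto split: if_splits)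
    moreover have "f x \<noteq> v" if "x \<in> set (drop k p)" for x
      using that arg_cong[OF t(2), of set] vn by auto
    moreover have "set (take k p) \<union> set (drop k p) = E" using p(1) by (metis append_take_drop_id set_append)
    ultimately have "set (take k p) = D" "set (drop k p) = E - D" unfolding D_def by blast+
    then have "(take k p, drop k p) \<in> permutations_of_set D \<times> ?R"
      using p t by (simp add: permutations_of_set_def)
    then show "p \<in> (\<lambda>(q, r). q @ r) ` (permutations_of_set D \<times> ?R)"
      by (rule rev_image_eqI) simp
  next
    fix p assume "p \<in> (\<lambda>(q, r). q @ r) ` (permutations_of_set D \<times> ?R)"
    then obtain q r where qr: "p = q @ r" "set q = D" "distinct q" "set r = E - D" "distinct r"
        "map f r = level_word vs a" by (auto simp: permutations_of_set_def)
    have "length q = k" using qr distinct_card cardD by fastforce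
    moreover have "map f q = map (\<lambda>_. v) q" using qr by (auto simp: D_def)
    ultimately have "map f p = level_word (v # vs) (k # a)" using qr by (simp add: map_replicate_const)
    then show "p \<in> {p \<in> permutations_of_set E. map f p = level_word (v # vs) (k # a)}"
      using qr by (auto simp: permutations_of_set_def D_def)
  qed
  have lenq: "length q = k" if "q \<in> permutations_of_set D" for q
    using that cardD by (simp add: length_finite_permutations_of_set)
  have inj: "inj_on (\<lambda>(q, r). q @ r) (permutations_of_set D \<times> ?R)"
    by (rule inj_onI) (auto simp: lenq)
  have "(\<Sum>p\<in>{p \<in> permutations_of_set E. map f p = level_word (v # vs) (k # a)}.
      comp_weight (k # a) (map (\<lambda>x. x \<in> B) p)) =
      (\<Sum>(q, r)\<in>permutations_of_set D \<times> ?R.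
        block_weight False (map (\<lambda>x. x \<in> B) q) * (comp_weight a (map (\<lambda>x. x \<in> B) r) :: 'a))"
    unfolding img sum.reindex[OF inj] by (rule sum.cong) (auto simp: lenq)
  also have "\<dots> = (\<Sum>q\<in>permutations_of_set D. block_weight False (map (\<lambda>x. x \<in> B) q)) *
      (\<Sum>r\<in>?R. comp_weight a (map (\<lambda>x. x \<in> B) r))"
    by (simp add: sum_product sum.cartesian_product)
  also have "\<dots> = 1"
  proof -
    have "(\<Sum>q\<in>permutations_of_set D. block_weight False (map (\<lambda>x. x \<in> B) q)) = (1::'a)"
      by (rule sum_permutations_block_weight)
        (use fin fact_nonzero_le[OF Cons.prems(4)] Cons.prems(2) in \<open>auto simp: D_def card_mono\<close>)
    moreover have "(\<Sum>r\<in>?R. comp_weight a (map (\<lambda>x. x \<in> B) r)) = (1::'a)"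
      by (rule Cons.IH)
        (use fin rest fact_nonzero_le[OF Cons.prems(4)] Cons.prems(1,2) in \<open>auto simp: card_mono\<close>)
    ultimately show ?thesis by simp
  qed
  finally show ?case .
qed

lemma lookup_sum_single:
  assumes "finite E"
  shows "Poly_Mapping.lookup (\<Sum>e\<in>E. Poly_Mapping.single (f e) (1::nat)) k =
    count (image_mset f (mset_set E)) k"
  using assms by (induction E rule: finite_induct) (auto simp: lookup_add lookup_single)

lemma lookup_xmon_level_word:
  assumes "length vs = length a"
  shows "Poly_Mapping.lookup (xmon vs a) k = count (mset (level_word vs a)) k"
  using assms
proof (induction vs a rule: list_induct2)
  case (Cons v vs j a)
  have "Poly_Mapping.lookup (xmon (v # vs) (j # a)) k =
      (if v = k then j else 0) + Poly_Mapping.lookup (xmon vs a) k"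
    by (simp add: lookup_xmon sum.lessThan_Suc_shift del: sum.lessThan_Suc cong: if_cong)
  then show ?case using Cons by simp
qed (simp add: lookup_xmon)

lemma content_iff:
  assumes "finite E" "length vs = length a"
  shows "(\<Sum>e\<in>E. Poly_Mapping.single (f e) (1::nat)) = xmon vs a \<longleftrightarrow>
    image_mset f (mset_set E) = mset (level_word vs a)"
  by (simp add: poly_mapping_eq_iff fun_eq_iff multiset_eq_iff lookup_sum_single[OF assms(1)]
      lookup_xmon_level_word[OF assms(2)] del: One_nat_def)

section \<open>The coefficient formula and quasisymmetry\<close>

text \<open>Each ordering \<open>p\<close> satisfies \<open>map f p = v\<close> for exactly one
  labelling \<open>f\<close>, so the orderings can be grouped by the labelling they induce.\<close>

lemma sum_permutations_labelling:
  fixes h :: "'e list \<Rightarrow> 'a::comm_monoid_add" and v :: "'b list"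
  assumes "finite E" "length v = card E"
  shows "(\<Sum>p\<in>permutations_of_set E. h p) =
    (\<Sum>f\<in>{f \<in> E \<rightarrow>\<^sub>E set v. image_mset f (mset_set E) = mset v}.
      \<Sum>p\<in>{p \<in> permutations_of_set E. map f p = v}. h p)"
proof -
  define g where "g p = restrict (\<lambda>e. the (map_of (zip p v) e)) E" for p
  have p_facts: "length p = length v" "set p = E" "distinct p" if "p \<in> permutations_of_set E" for p
    using that assms by (auto simp: permutations_of_set_def distinct_card[symmetric])
  have map_g: "map (g p) p = v" if "p \<in> permutations_of_set E" for p
  proof (rule nth_equalityI)
    fix i assume "i < length (map (g p) p)"
    then have i: "i < length p" by simp
    then have "p ! i \<in> E" using p_facts[OF that] nth_mem by blast
    then show "map (g p) p ! i = v ! i"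
      using i p_facts[OF that] by (simp add: g_def map_of_zip_nth)
  qed (simp add: p_facts[OF that])
  have unique: "f = g p" if "f \<in> extensional E" "p \<in> permutations_of_set E" "map f p = v" for f p
  proof (rule extensionalityI[OF that(1)])
    show "g p \<in> extensional E" by (simp add: g_def)
    fix x assume "x \<in> E"
    moreover have "map f p = map (g p) p" using that map_g by simp
    ultimately show "f x = g p x" using p_facts[OF that(2)] by (simp add: map_eq_conv)
  qed
  have mset_g: "image_mset (g p) (mset_set E) = mset v" if "p \<in> permutations_of_set E" for p
  proof -
    have "mset_set E = mset p" using p_facts[OF that] by (metis mset_set_set)
    then show ?thesis using map_g[OF that] by (metis mset_map)
  qed
  have finE: "finite (E \<rightarrow>\<^sub>E set v)" using assms(1) by (simp add: finite_PiE)
  let ?T = "{f \<in> E \<rightarrow>\<^sub>E set v. image_mset f (mset_set E) = mset v}"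
  have "(\<Sum>f\<in>?T. \<Sum>p\<in>{p \<in> permutations_of_set E. g p = f}. h p) = sum h (permutations_of_set E)"
  proof (rule sum.group)
    show "g ` permutations_of_set E \<subseteq> ?T"
    proof clarify
      fix p assume p: "p \<in> permutations_of_set E"
      have "g p x \<in> set v" if "x \<in> E" for x
        using that p_facts[OF p] arg_cong[OF map_g[OF p], of set] by auto
      then show "g p \<in> E \<rightarrow>\<^sub>E set v \<and> image_mset (g p) (mset_set E) = mset v"
        using mset_g[OF p] by (auto simp: g_def)
    qed
  qed (use assms finE in auto)
  moreover have "{p \<in> permutations_of_set E. g p = f} = {p \<in> permutations_of_set E. map f p = v}"
    if "f \<in> ?T" for f
    using that map_g unique by (auto simp: PiE_def)
  ultimately show ?thesis by simp
qed

text \<open>Group the orderings by labellings with monomial \<open>xmon vs a\<close>. A generic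
  labelling contributes 1, as all its sorted orderings have the same greedy base. A non-generic one
  contributes 0, as a nonzero weight would put non-jumps first in each level and force
  genericity.\<close>

theorem matroid_qsym_coefficient:
  assumes M: "matroid M" and vs: "index_seq (length a) vs"
    and a: "sum_list a = card (ground M)" and fact: "fct (card (ground M)) \<noteq> (0::'a::field)"
  shows "base_change (matroid_qsym M) (xmon vs a) =
    (\<Sum>p\<in>permutations_of_set (ground M). comp_weight a (jumps M p) :: 'a)"
proof -
  let ?E = "ground M" and ?L = "level_word vs a"
  have fin: "finite ?E" using M by (simp add: matroid_def)
  have len: "length vs = length a" and vs0: "0 \<notin> set vs" and vs_sorted: "sorted_wrt (<) vs"
    and dist: "distinct vs"
    using vs index_seq_distinct by (auto simp: index_seq_def)
  have lenL: "length ?L = card ?E" using length_level_word[OF len] a by simp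
  have posL: "x \<ge> 1" if "x \<in> set ?L" for x
    using that set_level_word[OF len] vs0 by (metis One_nat_def Suc_leI gr0I subsetD)
  let ?T = "{f \<in> ?E \<rightarrow>\<^sub>E set ?L. image_mset f (mset_set ?E) = mset ?L}"
  have finT: "finite ?T" using fin by (simp add: finite_PiE)
  have inner: "(\<Sum>p\<in>{p \<in> permutations_of_set ?E. map f p = ?L}. comp_weight a (jumps M p)) =
      (if generic M f then 1 else (0::'a))" if f: "f \<in> ?T" for f
  proof -
    have p_facts: "distinct p" "set p = ?E" "sorted (map f p)"
      if "p \<in> {p \<in> permutations_of_set ?E. map f p = ?L}" for p
      using that sorted_level_word[OF len vs_sorted] by (auto simp: permutations_of_set_def)
    show ?thesis
    proof (cases "generic M f")
      case True
      then obtain B where B: "B \<in> bases M" "\<forall>B'\<in>bases M. sum f B \<le> sum f B'"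
        unfolding generic_def by blast
      have "jumps M p = map (\<lambda>x. x \<in> B) p" if "p \<in> {p \<in> permutations_of_set ?E. map f p = ?L}" for p
        using jumps_eq_map_greedy[of p M] generic_greedy[OF M p_facts[OF that] True B] p_facts[OF that]
        by simp
      then have "(\<Sum>p\<in>{p \<in> permutations_of_set ?E. map f p = ?L}. comp_weight a (jumps M p)) =
        (\<Sum>p\<in>{p \<in> permutations_of_set ?E. map f p = ?L}. comp_weight a (map (\<lambda>x. x \<in> B) p) :: 'a)"
        by (intro sum.cong) auto
      also have "\<dots> = 1"
        by (rule sum_sorted_permutations_comp_weight) (use len dist fin f fact in auto)
      finally show ?thesis using True by simp
    next
      case False
      have "comp_weight a (jumps M p) = (0::'a)"
        if p: "p \<in> {p \<in> permutations_of_set ?E. map f p = ?L}" for p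
      proof (rule ccontr)
        assume nz: "\<not> ?thesis"
        have lenp: "length p = card ?E" using p_facts[OF p] distinct_card by fastforce
        have "generic M f"
        proof (rule generic_if_nonjumps_first[OF M p_facts[OF p]])
          show "f e \<ge> 1" if "e \<in> ?E" for e using f that posL by auto
          fix i j assume ij: "i < j" "j < length p" "f (p ! i) = f (p ! j)" "jumps M p ! i"
          have nth: "?L ! t = f (p ! t)" if "t < length p" for t using p that nth_map[OF that, of f] by simp
          show "jumps M p ! j"
            by (rule comp_weight_nonzero_mono[OF nz _ len dist ij(1)])
              (use ij nth[of i] nth[of j] lenp a in auto)
        qed
        with False show False by simp
      qed
      then show ?thesis using False by simp
    qed
  qed
  have fibre: "{f \<in> ?E \<rightarrow>\<^sub>E {1..}. generic M f \<and>
      (\<Sum>e\<in>?E. Poly_Mapping.single (f e) 1) = xmon vs a} = {f \<in> ?T. generic M f}"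
  proof -
    have "f e \<in> set ?L" if "image_mset f (mset_set ?E) = mset ?L" "e \<in> ?E" for f e
      using arg_cong[OF that(1), of set_mset] that(2) fin by auto
    then have "f \<in> ?E \<rightarrow>\<^sub>E {1..} \<longleftrightarrow> f \<in> ?E \<rightarrow>\<^sub>E set ?L" if "image_mset f (mset_set ?E) = mset ?L" for f
      using that posL unfolding PiE_iff atLeast_iff by blast
    then show ?thesis unfolding content_iff[OF fin len] by blast
  qed
  have "(\<Sum>p\<in>permutations_of_set ?E. comp_weight a (jumps M p) :: 'a) =
      (\<Sum>f\<in>?T. if generic M f then 1 else 0)"
    unfolding sum_permutations_labelling[OF fin lenL] by (rule sum.cong[OF refl]) (rule inner)
  also have "\<dots> = of_nat (card {f \<in> ?T. generic M f})"
    using finT by (simp add: sum.If_cases Int_def)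
  finally show ?thesis by (simp only: base_change_def matroid_qsym_def fibre of_int_of_nat_eq)
qed

lemma matroid_qsym_support:
  assumes "finite (ground M)" "matroid_qsym M m \<noteq> 0"
  shows "0 \<notin> Poly_Mapping.keys m" "mdeg m = card (ground M)"
proof -
  let ?E = "ground M"
  have "card {f \<in> ?E \<rightarrow>\<^sub>E {1..}. generic M f \<and> (\<Sum>e\<in>?E. Poly_Mapping.single (f e) 1) = m} \<noteq> 0"
    using assms(2) by (simp add: matroid_qsym_def)
  then obtain f where f: "f \<in> ?E \<rightarrow>\<^sub>E {1..}" and m: "(\<Sum>e\<in>?E. Poly_Mapping.single (f e) 1) = m"
    by (metis (mono_tags, lifting) card.empty empty_Collect_eq)
  have lookup: "Poly_Mapping.lookup m k = count (image_mset f (mset_set ?E)) k" for k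
    using lookup_sum_single[OF assms(1), of f k] m by simp
  have keys: "Poly_Mapping.keys m = f ` ?E"
    using assms(1) by (auto simp: in_keys_iff lookup count_eq_zero_iff)
  have "f e \<noteq> 0" if "e \<in> ?E" for e using PiE_mem[OF f that] by simp
  then have "0 \<notin> f ` ?E" by (metis imageE)
  then show "0 \<notin> Poly_Mapping.keys m" by (simp add: keys)
  have "mdeg m = size (image_mset f (mset_set ?E))"
    unfolding mdeg_def keys size_multiset_overloaded_eq using assms(1) by (simp add: lookup)
  then show "mdeg m = card ?E" by simp
qed

text \<open>In the coefficient formula the variable indices do not occur, which is quasisymmetry; in
  any other degree both coefficients are 0.\<close>

lemma matroid_qsym_QSym:
  assumes M: "matroid M" and fact: "fct (card (ground M)) \<noteq> (0::'a::field)"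
  shows "base_change (matroid_qsym M) \<in> (QSym (card (ground M)) :: 'a pseries set)"
proof (rule QSym_I)
  have fin: "finite (ground M)" using M by (simp add: matroid_def)
  fix m assume "base_change (matroid_qsym M) m \<noteq> (0::'a)"
  then have "matroid_qsym M m \<noteq> 0" by (auto simp: base_change_def)
  then show "0 \<notin> Poly_Mapping.keys m \<and> mdeg m = card (ground M)"
    using matroid_qsym_support[OF fin] by blast
next
  have fin: "finite (ground M)" using M by (simp add: matroid_def)
  fix a p q :: "nat list"
  assume a: "0 \<notin> set a" and p: "index_seq (length a) p" and q: "index_seq (length a) q"
  show "base_change (matroid_qsym M) (xmon p a) = (base_change (matroid_qsym M) (xmon q a) :: 'a)"
  proof (cases "sum_list a = card (ground M)")
    case True
    then show ?thesis
      using matroid_qsym_coefficient[OF M p True fact] matroid_qsym_coefficient[OF M q True fact] by simp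
  next
    case False
    have "mdeg (xmon r a) = sum_list a" if "index_seq (length a) r" for r
      using sum_list_comp_of[of "xmon r a"] comp_of_xmon(1)[OF that a] by simp
    then have "matroid_qsym M (xmon r a) = 0" if "index_seq (length a) r" for r
      using matroid_qsym_support(2)[OF fin] that False by metis
    then show ?thesis using p q by (simp add: base_change_def)
  qed
qed


section \<open>The matroids of binary strings\<close>

text \<open>The number is a product of factorials, but it need not be computed. Taking
  \<open>B\<close> empty in \<open>sum_sorted_permutations_comp_weight\<close> makes all words equal
  to 0^n, so the number times one fixed weight is 1.\<close>

lemma card_sorted_permutations_nonzero:
  fixes f :: "'e \<Rightarrow> nat"
  assumes "finite E" "sorted v" "image_mset f (mset_set E) = mset v" "fct (card E) \<noteq> (0::'a::field)"
  shows "of_nat (card {p \<in> permutations_of_set E. map f p = v}) \<noteq> (0::'a)"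
proof -
  define vs where "vs = sorted_list_of_set (set v)"
  define a where "a = map (count_list v) vs"
  have len: "length vs = length a" and dist: "distinct vs" by (simp_all add: a_def vs_def)
  have "mset (level_word vs a) = mset v"
  proof (rule multiset_eqI)
    fix k
    show "count (mset (level_word vs a)) k = count (mset v) k"
    proof (cases "k \<in> set v")
      case True
      then have "k \<in> set vs" by (simp add: vs_def)
      then obtain j where j: "j < length vs" "vs ! j = k" by (auto simp: in_set_conv_nth)
      have "count (mset (level_word vs a)) k = a ! j"
        using lookup_xmon_level_word[OF len, of k] lookup_xmon_nth[OF dist len, of j] j len by simp
      also have "\<dots> = count (mset v) k" using j by (simp add: a_def count_mset)
      finally show ?thesis .
    next
      case False
      then have "k \<notin> set (level_word vs a)" using set_level_word[OF len] by (auto simp: vs_def)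
      then show ?thesis using False by (simp add: count_mset count_list_0_iff)
    qed
  qed
  moreover have "sorted (level_word vs a)"
    by (rule sorted_level_word[OF len]) (simp add: vs_def)
  ultimately have lw: "level_word vs a = v"
    using assms(2) properties_for_sort sorted_sort_id by metis
  have const: "map (\<lambda>x. x \<in> {}) p = replicate (card E) False"
    if "p \<in> {p \<in> permutations_of_set E. map f p = v}" for p
    using that assms(1) by (auto simp: map_replicate_const length_finite_permutations_of_set)
  have "(\<Sum>p\<in>{p \<in> permutations_of_set E. map f p = v}.
      comp_weight a (replicate (card E) False)) = (1::'a)"
    using sum_sorted_permutations_comp_weight[OF len dist assms(1) _ assms(4), of f "{}"] assms(3)
    by (simp only: lw const cong: sum.cong)
  then show ?thesis by auto
qed

section \<open>Independence and rank in the string matroids\<close>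

lemma string_matroid_snoc:
  "string_matroid (\<sigma> @ [s]) =
     (if s = 0 then isthmus_ext (length \<sigma>) else principal_ext (length \<sigma>)) (string_matroid \<sigma>)"
  by (simp add: string_matroid_def enumerate_append_eq)

lemma bases_isthmus_ext: "bases (isthmus_ext e M) = insert e ` bases M"
  by (auto simp: isthmus_ext_def direct_sum_def isthmus_def)

lemma indep_isthmus_ext: "indep (isthmus_ext e M) S \<longleftrightarrow> indep M (S - {e})"
  by (auto simp: indep_def bases_isthmus_ext subset_insert_iff)

text \<open>The new element is placed freely: it may join any independent set that is not a base.
  The required \<open>J\<close> arises from a base containing \<open>S - {e}\<close> by dropping an
  element outside that set.\<close>

lemma indep_principal_ext:
  assumes M: "matroid M" and e: "e \<notin> ground M"
  shows "indep (principal_ext e M) S \<longleftrightarrow>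
    indep M (S - {e}) \<and> (e \<in> S \<longrightarrow> card (S - {e}) < rank M)"
proof
  assume "indep (principal_ext e M) S"
  then consider B where "B \<in> bases M" "S \<subseteq> B"
    | J where "indep M J" "card J + 1 = rank M" "S \<subseteq> insert e J"
    by (auto simp: indep_def principal_ext_def)
  then show "indep M (S - {e}) \<and> (e \<in> S \<longrightarrow> card (S - {e}) < rank M)"
  proof cases
    case 1
    then show ?thesis using M e by (auto simp: indep_def matroid_def)
  next
    case 2
    then have sub: "S - {e} \<subseteq> J" by auto
    then have "card (S - {e}) \<le> card J" by (intro card_mono indep_finite[OF M 2(1)])
    then have "card (S - {e}) < rank M" using 2(2) by linarith
    then show ?thesis using indep_subset[OF M 2(1) sub] by blast
  qed
next
  assume S: "indep M (S - {e}) \<and> (e \<in> S \<longrightarrow> card (S - {e}) < rank M)"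
  then obtain B where B: "B \<in> bases M" "S - {e} \<subseteq> B" by (auto simp: indep_def)
  show "indep (principal_ext e M) S"
  proof (cases "e \<in> S")
    case False
    then show ?thesis using B by (auto simp: indep_def principal_ext_def)
  next
    case True
    have "card (S - {e}) < card B" using S True matroid_base_card[OF M B(1)] by simp
    then obtain x where x: "x \<in> B" "x \<notin> S - {e}" using B(2) by (metis less_irrefl subsetI subset_antisym)
    have "indep M (B - {x})" using B by (auto simp: indep_def)
    moreover have "card (B - {x}) + 1 = rank M"
      using card_Suc_Diff1[OF matroid_base_finite[OF M B(1)] x(1)] matroid_base_card[OF M B(1)] by simp
    ultimately have "insert e (B - {x}) \<in> bases (principal_ext e M)" by (auto simp: principal_ext_def)
    moreover have "S \<subseteq> insert e (B - {x})" using x B by auto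
    ultimately show ?thesis by (auto simp: indep_def)
  qed
qed

text \<open>For \<open>i \<le> length \<sigma>\<close>, the rank of the matroid built by the first
  \<open>i\<close> letters.\<close>

definition zeros :: "nat list \<Rightarrow> nat \<Rightarrow> nat" where
  "zeros \<sigma> i = card {k. k < i \<and> k < length \<sigma> \<and> \<sigma> ! k = 0}"

lemma zeros_0 [simp]: "zeros \<sigma> 0 = 0"
  by (simp add: zeros_def)

lemma zeros_Suc:
  assumes "i < length \<sigma>"
  shows "zeros \<sigma> (Suc i) = zeros \<sigma> i + (if \<sigma> ! i = 0 then 1 else 0)"
proof -
  have "{k. k < Suc i \<and> k < length \<sigma> \<and> \<sigma> ! k = 0} =
      (if \<sigma> ! i = 0 then insert i else id) {k. k < i \<and> k < length \<sigma> \<and> \<sigma> ! k = 0}"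
    using assms by (auto simp: less_Suc_eq)
  then show ?thesis by (simp add: zeros_def)
qed

lemma zeros_mono: "i \<le> j \<Longrightarrow> zeros \<sigma> i \<le> zeros \<sigma> j"
  unfolding zeros_def by (intro card_mono) auto

lemma zeros_append: "i \<le> length \<sigma> \<Longrightarrow> zeros (\<sigma> @ \<tau>) i = zeros \<sigma> i"
  unfolding zeros_def by (rule arg_cong[where f = card]) (auto simp: nth_append)

lemma zeros_snoc: "zeros (\<sigma> @ [s]) (Suc (length \<sigma>)) = zeros \<sigma> (length \<sigma>) + (if s = 0 then 1 else 0)"
  by (simp add: zeros_Suc zeros_append)

lemma matroid_string: "matroid (string_matroid \<sigma>)" and ground_string: "ground (string_matroid \<sigma>) = {..<length \<sigma>}"
  using matroid_string_matroid by auto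

lemma rank_string_matroid: "rank (string_matroid \<sigma>) = zeros \<sigma> (length \<sigma>)"
proof (induction \<sigma> rule: rev_induct)
  case Nil
  have "{} \<in> bases (string_matroid [])" by (simp add: string_matroid_def empty_matroid_def)
  then show ?case using matroid_base_card[OF matroid_string] by fastforce
next
  case (snoc s \<sigma>)
  let ?M = "string_matroid \<sigma>" and ?N = "string_matroid (\<sigma> @ [s])"
  obtain B where B: "B \<in> bases ?M" using matroid_string[of \<sigma>] by (auto simp: matroid_def)
  have fin: "finite B" using matroid_base_finite[OF matroid_string B] .
  have nB: "length \<sigma> \<notin> B" using matroid_string[of \<sigma>] B ground_string[of \<sigma>] by (auto simp: matroid_def)
  show ?case
  proof (cases "s = 0")
    case True
    then have "insert (length \<sigma>) B \<in> bases ?N" using B by (simp add: string_matroid_snoc bases_isthmus_ext)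
    then have "rank ?N = Suc (card B)"
      using matroid_base_card[OF matroid_string] nB fin by fastforce
    then show ?thesis using True snoc matroid_base_card[OF matroid_string B] by (simp add: zeros_snoc)
  next
    case False
    then have "B \<in> bases ?N" using B by (simp add: string_matroid_snoc principal_ext_def)
    then have "rank ?N = card B" using matroid_base_card[OF matroid_string] by fastforce
    then show ?thesis using False snoc matroid_base_card[OF matroid_string B] by (simp add: zeros_snoc)
  qed
qed

text \<open>An isthmus raises the last bound by one, which leaves room for the new element in any
  independent set. A principal extension keeps the last bound, and this is exactly the rank
  condition in \<open>indep_principal_ext\<close>.\<close>

lemma indep_string_matroid:
  "indep (string_matroid \<sigma>) S \<longleftrightarrow>
    S \<subseteq> {..<length \<sigma>} \<and> (\<forall>i\<le>length \<sigma>. card (S \<inter> {..<i}) \<le> zeros \<sigma> i)"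
proof (induction \<sigma> arbitrary: S rule: rev_induct)
  case Nil
  then show ?case by (auto simp: string_matroid_def empty_matroid_def indep_def)
next
  case (snoc s \<sigma>)
  let ?n = "length \<sigma>"
  have e: "?n \<notin> ground (string_matroid \<sigma>)" by (simp add: ground_string)
  have sub: "S - {?n} \<subseteq> {..<?n} \<longleftrightarrow> S \<subseteq> {..<Suc ?n}" by (auto simp: less_Suc_eq)
  have early: "(S - {?n}) \<inter> {..<i} = S \<inter> {..<i}" if "i \<le> ?n" for i using that by auto
  have IH: "indep (string_matroid \<sigma>) (S - {?n}) \<longleftrightarrow>
      S \<subseteq> {..<Suc ?n} \<and> (\<forall>i\<le>?n. card (S \<inter> {..<i}) \<le> zeros \<sigma> i)"
    unfolding snoc sub by (simp add: early)
  have last: "(\<forall>i\<le>Suc ?n. card (S \<inter> {..<i}) \<le> zeros (\<sigma> @ [s]) i) \<longleftrightarrow>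
      (\<forall>i\<le>?n. card (S \<inter> {..<i}) \<le> zeros \<sigma> i) \<and>
      card (S \<inter> {..<Suc ?n}) \<le> zeros \<sigma> ?n + (if s = 0 then 1 else 0)"
    by (simp add: le_Suc_eq all_conj_distrib imp_conjR disj_imp zeros_append zeros_snoc) (auto simp: zeros_append zeros_snoc)
  have full: "card (S \<inter> {..<Suc ?n}) = card (S \<inter> {..<?n}) + (if ?n \<in> S then 1 else 0)"
  proof -
    have "S \<inter> {..<Suc ?n} = (if ?n \<in> S then insert ?n else id) (S \<inter> {..<?n})" by (auto simp: less_Suc_eq)
    then show ?thesis by simp
  qed
  show ?case
  proof (cases "s = 0")
    case True
    then show ?thesis
      unfolding string_matroid_snoc length_append_singleton last full
      by (auto simp: indep_isthmus_ext IH)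
  next
    case False
    have "card (S - {?n}) = card (S \<inter> {..<?n})" if "S \<subseteq> {..<Suc ?n}"
      using that sub early[of ?n] by (metis inf.absorb1 order_refl)
    then show ?thesis
      unfolding string_matroid_snoc length_append_singleton last full
      using False by (auto simp: indep_principal_ext[OF matroid_string e] IH rank_string_matroid)
  qed
qed

text \<open>The independent set consists of the \<open>i\<close>-th smallest elements of \<open>S\<close> for those \<open>i\<close> with \<open>\<sigma>\<^sub>i = 0\<close>.\<close>

lemma scattered_indep:
  assumes "S \<subseteq> {..<length \<sigma>}"
  obtains J where "J \<subseteq> S" "card J = zeros \<sigma> (card S)" "\<And>j. card (J \<inter> {..<j}) \<le> zeros \<sigma> j"
proof -
  define s where "s = sorted_list_of_set S"
  have fin: "finite S" using assms finite_subset by blast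
  have s: "set s = S" "distinct s" "length s = card S" "sorted_wrt (<) s"
    using fin by (simp_all add: s_def)
  \<comment> \<open>Consequently a chosen element below \<open>j\<close> has its index below
    \<open>j\<close> too, at a 0 of \<open>\<sigma>\<close>.\<close>
  have ge: "i \<le> s ! i" if "i < length s" for i
    using that
  proof (induction i)
    case (Suc i)
    then have "s ! i < s ! Suc i" using s(4) by (simp add: sorted_wrt_nth_less)
    then show ?case using Suc by simp
  qed simp
  have cn: "card S \<le> length \<sigma>" using assms card_mono[of "{..<length \<sigma>}" S] by simp
  let ?I = "{k. k < card S \<and> k < length \<sigma> \<and> \<sigma> ! k = 0}"
  define J where "J = (!) s ` ?I"
  have "card J = zeros \<sigma> (card S)"
    unfolding J_def zeros_def
    by (rule card_image) (use s in \<open>auto intro!: inj_onI simp: nth_eq_iff_index_eq\<close>)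
  moreover have "J \<subseteq> S" using s by (auto simp: J_def)
  moreover have "card (J \<inter> {..<j}) \<le> zeros \<sigma> j" for j
  proof -
    have "J \<inter> {..<j} \<subseteq> (!) s ` {k. k < j \<and> k < length \<sigma> \<and> \<sigma> ! k = 0}"
      using ge s(3) by (fastforce simp: J_def)
    then show ?thesis unfolding zeros_def by (intro surj_card_le) auto
  qed
  ultimately show ?thesis using that by blast
qed

text \<open>Every jump word therefore dominates the complement of \<open>\<sigma>\<close>.\<close>

lemma rk_string_matroid_ge:
  assumes "S \<subseteq> {..<length \<sigma>}"
  shows "zeros \<sigma> (card S) \<le> rk (string_matroid \<sigma>) S"
proof -
  obtain J where J: "J \<subseteq> S" "card J = zeros \<sigma> (card S)" "\<And>j. card (J \<inter> {..<j}) \<le> zeros \<sigma> j"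
    using scattered_indep[OF assms] by blast
  then have "indep (string_matroid \<sigma>) J" using assms by (auto simp: indep_string_matroid)
  then show ?thesis using indep_card_le_rk[OF matroid_string _ J(1)] J(2) by fastforce
qed

lemma rk_string_matroid_initial:
  assumes "c \<le> length \<sigma>"
  shows "rk (string_matroid \<sigma>) {..<c} \<le> zeros \<sigma> c"
proof -
  obtain J where J: "J \<subseteq> {..<c}" "indep (string_matroid \<sigma>) J" "card J = rk (string_matroid \<sigma>) {..<c}"
    by (rule rk_witness[OF matroid_string])
  then have "card (J \<inter> {..<c}) \<le> zeros \<sigma> c" using assms by (simp add: indep_string_matroid)
  then show ?thesis using J by (simp add: inf.absorb1)
qed

text \<open>A 0 preceded by a 1: the initial segments ending there are the proper nonempty cyclic flats, whose rank
  forces any ordering realising the minimal jump word to list them first.\<close>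

definition run_start :: "nat list \<Rightarrow> nat \<Rightarrow> bool" where
  "run_start \<sigma> c \<longleftrightarrow> 0 < c \<and> c < length \<sigma> \<and> \<sigma> ! (c - 1) \<noteq> 0 \<and> \<sigma> ! c = 0"

text \<open>Suppose some x in \<open>S\<close> is at least \<open>c\<close>. The other
  \<open>c - 1\<close> elements contain an independent set of size \<open>zeros \<sigma> c\<close>,
  since the letter before the cut is a 1. The 0 at \<open>c\<close> leaves room for x, so the rank
  of \<open>S\<close> would be too large.\<close>

lemma rk_cut_determines_set:
  assumes S: "S \<subseteq> {..<length \<sigma>}" "card S = c" and c: "run_start \<sigma> c"
    and rk: "rk (string_matroid \<sigma>) S \<le> zeros \<sigma> c"
  shows "S = {..<c}"
proof (rule ccontr)
  assume "S \<noteq> {..<c}"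
  have fin: "finite S" using S finite_subset by blast
  have "\<not> S \<subseteq> {..<c}" using \<open>S \<noteq> {..<c}\<close> S(2) by (metis card_lessThan card_subset_eq finite_lessThan)
  then obtain x where x: "x \<in> S" "c \<le> x" by (meson lessThan_iff not_less subsetI)
  obtain J where J: "J \<subseteq> S - {x}" "card J = zeros \<sigma> (card (S - {x}))"
      "\<And>j. card (J \<inter> {..<j}) \<le> zeros \<sigma> j"
    using scattered_indep[of "S - {x}" \<sigma>] S(1) by blast
  have finJ: "finite J" using J(1) fin finite_subset by blast
  have "card (S - {x}) = c - 1" using x S fin by simp
  moreover have "zeros \<sigma> c = zeros \<sigma> (c - 1)"
    using c zeros_Suc[of "c - 1" \<sigma>] by (auto simp: run_start_def)
  ultimately have cardJ: "card J = zeros \<sigma> c" using J(2) by simp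
  have zc: "zeros \<sigma> (Suc c) = Suc (zeros \<sigma> c)" using c zeros_Suc[of c \<sigma>] by (simp add: run_start_def)
  have "card (insert x J \<inter> {..<j}) \<le> zeros \<sigma> j" for j
  proof (cases "j \<le> c")
    case True
    then have "insert x J \<inter> {..<j} = J \<inter> {..<j}" using x by auto
    then show ?thesis using J(3) by simp
  next
    case False
    have "card (insert x J \<inter> {..<j}) \<le> card (insert x J)" using finJ by (intro card_mono) auto
    also have "\<dots> \<le> Suc (card J)" by (simp add: card_insert_le_m1 finJ card_insert_if)
    also have "\<dots> \<le> zeros \<sigma> j" using cardJ zc zeros_mono[of "Suc c" j \<sigma>] False by simp
    finally show ?thesis .
  qed
  then have "indep (string_matroid \<sigma>) (insert x J)"
    using J(1) S(1) x by (auto simp: indep_string_matroid)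
  then have "card (insert x J) \<le> rk (string_matroid \<sigma>) S"
    by (rule indep_card_le_rk[OF matroid_string]) (use J x in auto)
  moreover have "card (insert x J) = Suc (card J)" using J(1) finJ by (intro card_insert_disjoint) auto
  ultimately show False using rk cardJ by simp
qed

section \<open>Orderings realising the minimal jump word\<close>

text \<open>The run starts cut \<open>\<sigma>\<close> into blocks 0^a 1^b; this numbers the block
  containing position \<open>e\<close>.\<close>

definition level :: "nat list \<Rightarrow> nat \<Rightarrow> nat" where
  "level \<sigma> e = card {c. c \<le> e \<and> run_start \<sigma> c}"

lemma level_mono: "d \<le> e \<Longrightarrow> level \<sigma> d \<le> level \<sigma> e"
  unfolding level_def by (intro card_mono) auto

lemma level_less_cut:
  assumes "run_start \<sigma> c" "d < c"
  shows "level \<sigma> d < level \<sigma> c"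
proof -
  have "insert c {b. b \<le> d \<and> run_start \<sigma> b} \<subseteq> {b. b \<le> c \<and> run_start \<sigma> b}" using assms by auto
  then have "card (insert c {b. b \<le> d \<and> run_start \<sigma> b}) \<le> level \<sigma> c"
    unfolding level_def by (intro card_mono) auto
  then show ?thesis using assms(2) by (simp add: level_def)
qed

text \<open>Minimal ranks force the first c entries to be \<open>{..<c}\<close> at every cut c, so
  each block is permuted within itself. Conversely, over the zeros of a block the rank grows by at
  most one per step, and over its ones it is bounded by the rank at the end of the block.\<close>

lemma minimal_ranks_iff_level:
  assumes p: "p \<in> permutations_of_set {..<length \<sigma>}"
  shows "(\<forall>i\<le>length \<sigma>. rk (string_matroid \<sigma>) (set (take i p)) = zeros \<sigma> i) \<longleftrightarrow>
    map (level \<sigma>) p = map (level \<sigma>) [0..<length \<sigma>]" (is "?ranks \<longleftrightarrow> ?levels")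
proof -
  let ?M = "string_matroid \<sigma>" and ?n = "length \<sigma>"
  have p_facts: "set p = {..<?n}" "distinct p" "length p = ?n"
    using p by (auto simp: permutations_of_set_def distinct_card[symmetric])
  have sub: "set (take i p) \<subseteq> {..<?n}" for i using set_take_subset p_facts(1) by metis
  have card_take: "card (set (take i p)) = i" if "i \<le> ?n" for i
    using that p_facts by (simp add: distinct_card)
  have in_take: "p ! i \<in> set (take c p) \<longleftrightarrow> i < c" if "i < ?n" for i c
  proof
    assume "p ! i \<in> set (take c p)"
    then obtain j where j: "j < c" "j < length p" "p ! j = p ! i" by (auto simp: in_set_conv_nth)
    then have "j = i" using that p_facts(2,3) by (simp add: nth_eq_iff_index_eq)
    with j show "i < c" by simp
  next
    assume "i < c"
    then show "p ! i \<in> set (take c p)"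
      using that p_facts(3) nth_mem[of i "take c p"] by simp
  qed
  have levels_iff: "?levels \<longleftrightarrow> (\<forall>i<?n. level \<sigma> (p ! i) = level \<sigma> i)"
    unfolding list_eq_iff_nth_eq using p_facts(3) by simp
  show ?thesis
  proof
    assume ranks: ?ranks
    have initial: "set (take c p) = {..<c}" if "run_start \<sigma> c" for c
      using rk_cut_determines_set[OF sub card_take that] ranks that by (simp add: run_start_def)
    have "level \<sigma> (p ! i) = level \<sigma> i" if "i < ?n" for i
    proof -
      have "c \<le> p ! i \<longleftrightarrow> c \<le> i" if "run_start \<sigma> c" for c
        using in_take[OF \<open>i < ?n\<close>, of c] unfolding initial[OF that] lessThan_iff by linarith
      then have "{c. c \<le> p ! i \<and> run_start \<sigma> c} = {c. c \<le> i \<and> run_start \<sigma> c}" by auto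
      then show ?thesis by (simp add: level_def)
    qed
    then show ?levels using levels_iff by blast
  next
    assume ?levels
    then have lev: "level \<sigma> (p ! i) = level \<sigma> i" if "i < ?n" for i using levels_iff that by blast
    have initial: "set (take c p) = {..<c}" if "run_start \<sigma> c \<or> c = ?n" for c
    proof (cases "c = ?n")
      case False
      with that have c: "run_start \<sigma> c" "c < ?n" by (auto simp: run_start_def)
      have "set (take c p) \<subseteq> {..<c}"
      proof
        fix x assume "x \<in> set (take c p)"
        then obtain i where i: "i < c" "x = p ! i" by (auto simp: in_set_conv_nth)
        then have "level \<sigma> x < level \<sigma> c" using lev[of i] level_less_cut[OF c(1), of i] c by simp
        then show "x \<in> {..<c}" using level_mono[of c x \<sigma>] by (auto simp: not_less[symmetric])
      qed
      then show ?thesis using card_take[of c] c by (intro card_subset_eq) auto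
    qed (use p_facts in simp)
    have "rk ?M (set (take i p)) \<le> zeros \<sigma> i" if "i \<le> ?n" for i
      using that
    proof (induction i)
      case 0
      then show ?case by (simp add: rk_empty[OF matroid_string])
    next
      case (Suc i)
      then have i: "i < ?n" by simp
      show ?case
      proof (cases "\<sigma> ! i = 0")
        case True
        have "set (take (Suc i) p) = insert (p ! i) (set (take i p))"
          using i p_facts by (simp add: take_Suc_conv_app_nth)
        then show ?thesis
          using rk_insert_le[OF matroid_string, of \<sigma> "p ! i" "set (take i p)"] Suc.IH i True
          by (simp add: zeros_Suc)
      next
        case False
        \<comment> \<open>The end of the block containing position \<open>i\<close>. From
          \<open>i\<close> up to \<open>c\<close> there are only ones, because a 0 after a 1 would
          be an earlier cut; so \<open>zeros\<close> stays constant there.\<close>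
        define c where "c = (LEAST c. Suc i \<le> c \<and> (run_start \<sigma> c \<or> c = ?n))"
        have c: "Suc i \<le> c \<and> (run_start \<sigma> c \<or> c = ?n)"
          unfolding c_def by (rule LeastI[of _ ?n]) (use i in simp)
        have not_cut: "\<not> run_start \<sigma> k" if "Suc i \<le> k" "k < c" for k
          using not_less_Least[of k "\<lambda>c. Suc i \<le> c \<and> (run_start \<sigma> c \<or> c = ?n)"] that by (auto simp: c_def)
        have cn: "c \<le> ?n" using c by (auto simp: run_start_def)
        have ones: "\<sigma> ! k \<noteq> 0" if "i \<le> k" "k < c" for k
          using that
        proof (induction k rule: dec_induct)
          case (step k)
          then show ?case using not_cut[of "Suc k"] cn by (auto simp: run_start_def)
        qed (use False in simp)
        have "zeros \<sigma> k = zeros \<sigma> i" if "i \<le> k" "k \<le> c" for k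
          using that
        proof (induction k rule: dec_induct)
          case (step k)
          then show ?case using zeros_Suc[of k \<sigma>] ones[of k] cn by simp
        qed simp
        from this[of c] this[of "Suc i"] have z: "zeros \<sigma> c = zeros \<sigma> (Suc i)" using c by simp
        have "rk ?M (set (take (Suc i) p)) \<le> rk ?M (set (take c p))"
          using c by (intro rk_mono[OF matroid_string] set_take_subset_set_take) simp
        also have "\<dots> \<le> zeros \<sigma> c" using initial[of c] c rk_string_matroid_initial[OF cn] by simp
        finally show ?thesis using z by simp
      qed
    qed
    moreover have "zeros \<sigma> i \<le> rk ?M (set (take i p))" if "i \<le> ?n" for i
      using rk_string_matroid_ge[OF sub, of i] card_take[OF that] by simp
    ultimately show ?ranks by (simp add: le_antisym)
  qed
qed

section \<open>Triangularity with respect to dominance\<close>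

lemma count_take_Suc:
  "i < length w \<Longrightarrow> count_list (take (Suc i) w) x = count_list (take i w) x + (if w ! i = x then 1 else 0)"
  by (simp add: take_Suc_conv_app_nth)

lemma bool_list_eqI_prefix_counts:
  assumes "length w = length u" "\<And>i. i \<le> length u \<Longrightarrow> count_list (take i w) True = count_list (take i u) True"
  shows "w = u"
proof (rule nth_equalityI[OF assms(1)])
  fix i assume "i < length w"
  then show "w ! i = u ! i"
    using assms(1) assms(2)[of i] assms(2)[of "Suc i"]
    by (auto simp: count_take_Suc split: if_splits)
qed

lemma count_take_eq_zeros:
  assumes "i \<le> length \<sigma>"
  shows "count_list (take i (map (\<lambda>s. s = 0) \<sigma>)) True = zeros \<sigma> i"
  using assms
proof (induction i)
  case (Suc i)
  then show ?case using count_take_Suc[of i "map (\<lambda>s. s = 0) \<sigma>" True] by (simp add: zeros_Suc)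
qed simp

text \<open>Among words of equal length this strictly increases along strict dominance; being
  bounded, it gives a measure for induction from the dominant words downwards.\<close>

definition prefix_count_sum :: "bool list \<Rightarrow> nat" where
  "prefix_count_sum w = (\<Sum>i\<le>length w. count_list (take i w) True)"

lemma prefix_count_sum_le: "prefix_count_sum w \<le> Suc (length w) * length w"
proof -
  have "count_list (take i w) True \<le> length w" for i
    using count_le_length[of "take i w" True] by simp
  then have "prefix_count_sum w \<le> (\<Sum>i\<le>length w. length w)"
    unfolding prefix_count_sum_def by (intro sum_mono) auto
  then show ?thesis by simp
qed

text \<open>For \<open>\<sigma>\<close> complementary to \<open>w\<close>, all jump words dominate
  \<open>w\<close>, and by induction \<open>T\<close> vanishes on those different from
  \<open>w\<close>. What remains is \<open>T w\<close> times the number of orderings sorted by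
  \<open>level \<sigma>\<close>, which is nonzero in the field.\<close>

theorem string_matroid_jumps_triangular:
  fixes T :: "bool list \<Rightarrow> 'a::field"
  assumes n: "n \<ge> 1" and fact: "fct n \<noteq> (0::'a)"
    and zero: "\<And>\<sigma>. \<sigma> \<in> binary_strings0 n \<Longrightarrow>
      (\<Sum>p\<in>permutations_of_set {..<n}. T (jumps (string_matroid \<sigma>) p)) = 0"
    and w: "length w = n" "hd w"
  shows "T w = 0"
  using w
proof (induction w rule: measure_induct_rule[where f = "\<lambda>w. Suc n * n - prefix_count_sum w"])
  case (less w)
  define \<sigma> where "\<sigma> = map (\<lambda>b. if b then 0 else 1 :: nat) w"
  have len: "length \<sigma> = n" using less.prems by (simp add: \<sigma>_def)
  have w\<sigma>: "map (\<lambda>s. s = 0) \<sigma> = w" by (simp add: \<sigma>_def comp_def)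
  have "w \<noteq> []" using less.prems n by auto
  then have \<sigma>: "\<sigma> \<in> binary_strings0 n" using less.prems len by (auto simp: binary_strings0_def \<sigma>_def hd_map)
  let ?M = "string_matroid \<sigma>" and ?P = "permutations_of_set {..<n}"
  have lenp: "length p = n" if "p \<in> ?P" for p
    using that by (simp add: length_finite_permutations_of_set)
  have counts: "count_list (take i w) True = zeros \<sigma> i" if "i \<le> n" for i
    using count_take_eq_zeros[of i \<sigma>] that len w\<sigma> by simp
  have dominates: "count_list (take i w) True \<le> count_list (take i (jumps ?M p)) True"
    if "p \<in> ?P" "i \<le> n" for p i
  proof -
    have "set p = {..<n}" "distinct p" using that(1) by (auto simp: permutations_of_set_def)
    then have "set (take i p) \<subseteq> {..<length \<sigma>}" "card (set (take i p)) = i"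
      using that lenp[OF that(1)] len set_take_subset[of i p] by (auto simp: distinct_card)
    then show ?thesis
      using rk_string_matroid_ge[of "set (take i p)" \<sigma>] that counts count_take_jumps[OF matroid_string] by simp
  qed
  have other: "T (jumps ?M p) = 0" if p: "p \<in> ?P" "jumps ?M p \<noteq> w" for p
  proof (rule less.IH)
    let ?u = "jumps ?M p"
    show lenu: "length ?u = n" using lenp[OF p(1)] by simp
    obtain i where i: "i \<le> n" "count_list (take i ?u) True \<noteq> count_list (take i w) True"
      using bool_list_eqI_prefix_counts[of ?u w] p(2) lenu less.prems by auto
    have "prefix_count_sum w < prefix_count_sum ?u"
      unfolding prefix_count_sum_def lenu less.prems(1)
    proof (rule sum_strict_mono_ex1)
      show "\<exists>i\<in>{..n}. count_list (take i w) True < count_list (take i ?u) True"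
        using i dominates[OF p(1) i(1)] by (intro bexI[of _ i]) auto
    qed (use dominates[OF p(1)] in auto)
    moreover have "prefix_count_sum ?u \<le> Suc n * n" using prefix_count_sum_le[of ?u] lenu by simp
    ultimately show "Suc n * n - prefix_count_sum ?u < Suc n * n - prefix_count_sum w" by linarith
    have ne: "?u \<noteq> []" using lenu n by (metis length_0_conv not_one_le_zero)
    \<comment> \<open>Dominance preserves the leading \<open>True\<close>, so the induction stays
      among words starting with \<open>True\<close>.\<close>
    have "take 1 w = [True]" using less.prems \<open>w \<noteq> []\<close> by (cases w) auto
    then have "1 \<le> count_list (take 1 ?u) True" using dominates[OF p(1), of 1] n by simp
    then show "hd ?u" using ne by (cases ?u) (auto split: if_splits)
  qed
  have "{p \<in> ?P. jumps ?M p = w} = {p \<in> ?P. map (level \<sigma>) p = map (level \<sigma>) [0..<n]}"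
  proof (rule Collect_cong, rule conj_cong[OF refl])
    fix p assume p: "p \<in> ?P"
    have "jumps ?M p = w \<longleftrightarrow> (\<forall>i\<le>n. count_list (take i (jumps ?M p)) True = count_list (take i w) True)"
      using bool_list_eqI_prefix_counts[of "jumps ?M p" w] lenp[OF p] less.prems by auto
    also have "\<dots> \<longleftrightarrow> (\<forall>i\<le>n. rk ?M (set (take i p)) = zeros \<sigma> i)"
      by (simp add: counts count_take_jumps[OF matroid_string])
    also have "\<dots> \<longleftrightarrow> map (level \<sigma>) p = map (level \<sigma>) [0..<n]"
      using minimal_ranks_iff_level[of p \<sigma>] p len by simp
    finally show "jumps ?M p = w \<longleftrightarrow> map (level \<sigma>) p = map (level \<sigma>) [0..<n]" .
  qed
  moreover have "of_nat (card {p \<in> ?P. map (level \<sigma>) p = map (level \<sigma>) [0..<n]}) \<noteq> (0::'a)"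
  proof (rule card_sorted_permutations_nonzero)
    show "sorted (map (level \<sigma>) [0..<n])" by (auto simp: sorted_iff_nth_mono intro!: level_mono)
    show "image_mset (level \<sigma>) (mset_set {..<n}) = mset (map (level \<sigma>) [0..<n])"
      by (simp add: mset_map mset_upt atLeast0LessThan)
  qed (use fact in auto)
  ultimately have nz: "of_nat (card {p \<in> ?P. jumps ?M p = w}) \<noteq> (0::'a)" by simp
  have "0 = (\<Sum>p\<in>?P. T (jumps ?M p))" using zero[OF \<sigma>] by simp
  also have "\<dots> = (\<Sum>p\<in>{p \<in> ?P. jumps ?M p = w}. T w)"
    by (rule sum.mono_neutral_cong_right) (use other in auto)
  also have "\<dots> = of_nat (card {p \<in> ?P. jumps ?M p = w}) * T w" by simp
  finally show ?case using nz by simp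
qed

section \<open>Duality and conclusion\<close>

text \<open>A maximal independent subset of \<open>W\<close> stays independent together with
  \<open>v\<close>; prescribing 0 on it and 1 at \<open>v\<close> extends to a linear form.\<close>

lemma separating_functional:
  fixes W :: "'a::field pseries set"
  assumes "v \<notin> pseries.span W"
  obtains \<phi> :: "'a pseries \<Rightarrow> 'a" where
    "\<And>g h. \<phi> (g + h) = \<phi> g + \<phi> h" "\<And>c g. \<phi> (pscale c g) = c * \<phi> g"
    "\<And>g. g \<in> W \<Longrightarrow> \<phi> g = 0" "\<phi> v = 1"
proof -
  interpret vp: vector_space_pair "pscale :: 'a \<Rightarrow> 'a pseries \<Rightarrow> 'a pseries" "(*) :: 'a \<Rightarrow> 'a \<Rightarrow> 'a"
    by unfold_locales (auto simp: algebra_simps)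
  obtain B where B: "B \<subseteq> W" "pseries.independent B" "W \<subseteq> pseries.span B"
    using pseries.maximal_independent_subset by blast
  have v: "v \<notin> pseries.span B"
    using assms pseries.span_mono[OF B(1)] by auto
  have "pseries.independent (insert v B)"
    using pseries.independent_insertI[OF v B(2)] .
  then obtain \<phi> where \<phi>: "Vector_Spaces.linear pscale (*) \<phi>"
      "\<forall>x\<in>insert v B. \<phi> x = (if x = v then 1 else (0::'a))"
    using vp.linear_independent_extend[of "insert v B" "\<lambda>x. if x = v then 1 else 0"] by blast
  have "v \<notin> B" using v pseries.span_base by blast
  then have "\<phi> g = 0" if "g \<in> B" for g using \<phi>(2) that by auto
  then have "\<phi> g = 0" if "g \<in> pseries.span B" for g
    using vp.linear_eq_0_on_span[OF \<phi>(1)] that by blast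
  then show ?thesis
    using that[of \<phi>] \<phi> B(3) vp.linear_add[OF \<phi>(1)] vp.linear_scale[OF \<phi>(1)] by auto
qed

theorem theorem10p2:
  fixes n :: nat
  assumes "n \<ge> 1"
    and "of_nat (fact n) \<noteq> (0 :: 'a::field)"
  shows "pseries.span ((\<lambda>\<sigma>. base_change (matroid_qsym (string_matroid \<sigma>))) ` binary_strings0 n)
       = (QSym n :: 'a pseries set)"
proof
  let ?F = "\<lambda>\<sigma>. base_change (matroid_qsym (string_matroid \<sigma>)) :: 'a pseries"
  have card_ground: "card (ground (string_matroid \<sigma>)) = n" if "\<sigma> \<in> binary_strings0 n" for \<sigma>
    using that by (simp add: ground_string binary_strings0_def)
  have F: "?F \<sigma> \<in> QSym n" if "\<sigma> \<in> binary_strings0 n" for \<sigma>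
    using matroid_qsym_QSym[OF matroid_string[of \<sigma>], where 'a='a] card_ground[OF that] assms(2) by simp
  have "pseries.subspace (QSym n :: 'a pseries set)"
    by (rule pseries.subspaceI) (use QSym_0 QSym_add QSym_scale in auto)
  then show "pseries.span (?F ` binary_strings0 n) \<subseteq> QSym n"
    using F by (intro pseries.span_minimal) auto
  show "QSym n \<subseteq> pseries.span (?F ` binary_strings0 n)"
  proof (rule subsetI, rule ccontr)
    fix v :: "'a pseries" assume v: "v \<in> QSym n" "v \<notin> pseries.span (?F ` binary_strings0 n)"
    obtain \<phi> :: "'a pseries \<Rightarrow> 'a" where add: "\<And>g h. \<phi> (g + h) = \<phi> g + \<phi> h"
      and scale: "\<And>c g. \<phi> (pscale c g) = c * \<phi> g"
      and vanish: "\<And>g. g \<in> ?F ` binary_strings0 n \<Longrightarrow> \<phi> g = 0" and one: "\<phi> v = 1"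
      using separating_functional[OF v(2)] by blast
    \<comment> \<open>With these values, \<open>word_eval n c w\<close> is \<open>\<phi>\<close>
      applied to \<psi>(w).\<close>
    define c where "c a = \<phi> (monoQ a)" for a
    have expand: "\<phi> g = (\<Sum>a\<in>comps n. c a * g (rep_mon a))" if "g \<in> QSym n" for g
    proof -
      have "\<phi> g = \<phi> (\<Sum>a\<in>comps n. pscale (g (rep_mon a)) (monoQ a))"
        using QSym_expand[OF that] by simp
      also have "\<dots> = (\<Sum>a\<in>comps n. \<phi> (pscale (g (rep_mon a)) (monoQ a)))"
        by (rule additive_on_sum[of n \<phi>, OF add finite_comps QSym_scale[OF monoQ_QSym], THEN conjunct2])
      finally show ?thesis by (simp add: scale c_def mult.commute)
    qed
    \<comment> \<open>The vanishing of \<open>\<phi>\<close> on each \<open>?F \<sigma>\<close>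
      becomes, after exchanging the sums over compositions and orderings, the hypothesis of the
      triangularity theorem.\<close>
    have "(\<Sum>p\<in>permutations_of_set {..<n}. word_eval n c (jumps (string_matroid \<sigma>) p)) = 0"
      if \<sigma>: "\<sigma> \<in> binary_strings0 n" for \<sigma>
    proof -
      have coeff: "?F \<sigma> (rep_mon a) =
          (\<Sum>p\<in>permutations_of_set {..<n}. comp_weight a (jumps (string_matroid \<sigma>) p))"
        if "a \<in> comps n" for a
        using matroid_qsym_coefficient[OF matroid_string index_seq_upt, of a \<sigma>, where 'a='a]
          card_ground[OF \<sigma>] ground_string[of \<sigma>] \<sigma> that assms(2)
        by (simp add: rep_mon_def comps_def binary_strings0_def)
      have "0 = (\<Sum>a\<in>comps n. c a * ?F \<sigma> (rep_mon a))"
        using vanish[of "?F \<sigma>"] expand[OF F[OF \<sigma>]] \<sigma> by simp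
      also have "\<dots> = (\<Sum>a\<in>comps n. \<Sum>p\<in>permutations_of_set {..<n}.
          c a * comp_weight a (jumps (string_matroid \<sigma>) p))"
        by (rule sum.cong[OF refl]) (simp only: coeff sum_distrib_left)
      also have "\<dots> = (\<Sum>p\<in>permutations_of_set {..<n}. word_eval n c (jumps (string_matroid \<sigma>) p))"
        unfolding word_eval_def by (rule sum.swap)
      finally show ?thesis by simp
    qed
    then have "word_eval n c w = 0" if "length w = n" "w = [] \<or> hd w" for w
      using string_matroid_jumps_triangular[OF assms, of "word_eval n c" w] that assms(1) by auto
    then have "c a = 0" if "a \<in> comps n" for a
      using word_eval_vanish[OF assms(2), of c a] that by blast
    then have "\<phi> v = 0" using expand[OF v(1)] by simp
    then show False using one by simp
  qed
qed

end
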